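(* Let $(\mathcal{C},\mathbb{E},\mathfrak{s})$ be an extriangulated category satisfying Condition (WIC), and let $\xi$ be a proper class of $\mathbb{E}$-triangles such that $\mathcal{C}$ has enough $\xi$-projectives and enough $\xi$-injectives. Let $A\in\mathcal{GP}^*(\xi)$ and $B\in\mathcal{GI}^*(\xi)$. Then $\xi\mathrm{xt}^n_{\mathcal{GP}(\xi)}(A,B)\simeq\xi\mathrm{xt}^n_{\mathcal{GI}(\xi)}(A,B)$ for every $n\geqslant 0$.
   Context: Extriangulated category: an additive category $\mathcal C$ with (ET1) a biadditive functor $\mathbb E:\mathcal C^{op}\times\mathcal C\to\mathbf{Ab}$ and a correspondence $\mathfrak s$ sending each $\delta\in\mathbb E(C,A)$ to a class $[A\xrightarrow{x}B\xrightarrow{y}C]$ of sequences modulo isomorphisms that are the identity on $A$ and $C$. Write $a_*\delta=\mathbb E(C,a)(\delta)$, $c^*\delta=\mathbb E(c,A)(\delta)$; a morphism from $\delta\in\mathbb E(C,A)$ to $\delta'\in\mathbb E(C',A')$ is a pair $(a:A\to A',c:C\to C')$ with $a_*\delta=c^*\delta'$. Axioms: (ET2) every morphism $(a,c)$ of extensions is realized by some $b$ making both squares between the realizing sequences commute, $\mathfrak s(0)=[A\to A\oplus C\to C]$, and $\mathfrak s(\delta\oplus\delta')=\mathfrak s(\delta)\oplus\mathfrak s(\delta')$; (ET3) if $\mathfrak s(\delta)=[A\xrightarrow{x}B\xrightarrow{y}C]$, $\mathfrak s(\delta')=[A'\xrightarrow{x'}B'\xrightarrow{y'}C']$ and $bx=x'a$,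 there is $c$ with $cy=y'b$ and $(a,c):\delta\to\delta'$ a morphism; (ET4) if $\delta\in\mathbb E(D,A)$, $\delta'\in\mathbb E(F,B)$ are realized by $A\xrightarrow{f}B\xrightarrow{f'}D$ and $B\xrightarrow{g}C\xrightarrow{g'}F$, there are an object $E$, $\delta''\in\mathbb E(E,A)$ realized by $A\xrightarrow{gf}C\xrightarrow{h'}E$, and $D\xrightarrow{d}E\xrightarrow{e}F$ realizing $f'_*\delta'$, with $h'g=df'$, $eh'=g'$, $d^*\delta''=\delta$, $f_*\delta''=e^*\delta'$; and the duals (ET3)$^{op}$, (ET4)$^{op}$. If $\mathfrak s(\delta)=[A\xrightarrow{x}B\xrightarrow{y}C]$, then $A\xrightarrow{x}B\xrightarrow{y}C\overset{\delta}{\dashrightarrow}$ is called an $\mathbb E$-triangle, $x$ an inflation, $y$ a deflation; it is split if $\delta=0$. Condition (WIC): for composable $f,g$, if $gf$ is an inflation so is $f$; if $gf$ is a deflation so is $g$. Proper class: a class $\xi$ of $\mathbb E$-triangles closed under isomorphisms such that (1) $\xi$ contains the split $\mathbb E$-triangles and is closed under finite coproducts; (2) if $A\to B\to C\overset{\delta}{\dashrightarrow}$ is in $\xi$, so is every $\mathbb E$-triangle realizing $c^*\delta$ or $a_*\delta$, for any $c:C'\to C$, $a:A\to A'$; (3) (saturated) for $\mathbb E$-triangles $A_i\xrightarrow{x_i}B_i\xrightarrow{y_i}C\overset{\delta_i}{\dashrightarrow}$, $i=1,2$, if the second one and the $\mathbb E$-triangle $A_1\to M\to B_2\overset{y_2^*\delta_1}{\dashrightarrow}$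 are in $\xi$, then the first one is in $\xi$. $P$ is $\xi$-projective if $0\to\mathcal C(P,A)\to\mathcal C(P,B)\to\mathcal C(P,C)\to0$ is exact for every $\mathbb E$-triangle $A\to B\to C\dashrightarrow$ in $\xi$; $\xi$-injective is dual. $\mathcal P(\xi)$, $\mathcal I(\xi)$ denote the corresponding classes. Enough $\xi$-projectives: each $A$ admits an $\mathbb E$-triangle $K\to P\to A\dashrightarrow$ in $\xi$ with $P\in\mathcal P(\xi)$; enough $\xi$-injectives is dual. $\xi\text{-pd}A$ is defined inductively: $\xi\text{-pd}\,0=-1$; $\xi\text{-pd}A=0$ for $0\neq A\in\mathcal P(\xi)$; $\xi\text{-pd}A\leqslant n$ if there is an $\mathbb E$-triangle $K\to P\to A\dashrightarrow$ in $\xi$ with $P\in\mathcal P(\xi)$ and $\xi\text{-pd}K\leqslant n-1$. $\xi\text{-id}$ is dual. For a class $\mathcal W$, an $\mathbb E$-triangle $A\to B\to C\dashrightarrow$ in $\xi$ is $\mathcal C(\mathcal W,-)$-exact if $0\to\mathcal C(W,A)\to\mathcal C(W,B)\to\mathcal C(W,C)\to0$ is exact for all $W\in\mathcal W$, and $\mathcal C(-,\mathcal W)$-exact if $0\to\mathcal C(C,W)\to\mathcal C(B,W)\to\mathcal C(A,W)\to0$ is exact for all $W\in\mathcal W$. A complex $\cdots\to X_1\xrightarrow{d_1}X_0\xrightarrow{d_0}X_{-1}\to\cdots$ is $\xi$-exact if there are $\mathbb E$-triangles $K_{n+1}\xrightarrow{g_n}X_n\xrightarrow{f_n}K_n\dashrightarrow$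 in $\xi$ (resolution $\mathbb E$-triangles) with $d_n=g_{n-1}f_n$ for all $n$. A complete $\xi$-projective resolution is a $\xi$-exact complex of $\xi$-projectives whose resolution $\mathbb E$-triangles are $\mathcal C(-,\mathcal P(\xi))$-exact; the objects $K_n$ occurring are called $\xi$-$\mathcal G$projective, forming $\mathcal{GP}(\xi)$. Dually ($\xi$-exact complexes of $\xi$-injectives with $\mathcal C(\mathcal I(\xi),-)$-exact resolution $\mathbb E$-triangles) one defines $\xi$-$\mathcal G$injective objects, forming $\mathcal{GI}(\xi)$. A proper $\xi$-$\mathcal G$projective resolution of $A$ is a $\xi$-exact complex $\cdots\to G_1\to G_0\to A\to0$ with all $G_i\in\mathcal{GP}(\xi)$ whose resolution $\mathbb E$-triangles $K_{i+1}\to G_i\to K_i\dashrightarrow$ ($K_0=A$) are $\mathcal C(\mathcal{GP}(\xi),-)$-exact; its deleted complex $\mathbf G^\sharp$ is $\cdots\to G_1\to G_0\to0$. Dually, a proper $\xi$-$\mathcal G$injective coresolution $0\to B\to H^0\to H^1\to\cdots$ has $H^i\in\mathcal{GI}(\xi)$ and $\mathcal C(-,\mathcal{GI}(\xi))$-exact resolution $\mathbb E$-triangles; its deleted complex is $\mathbf H_\sharp$. For $A$ having a proper $\xi$-$\mathcal G$projective resolution, $\xi\mathrm{xt}^n_{\mathcal{GP}(\xi)}(A,B):=H^n(\mathcal C(\mathbf G^\sharp,B))$; for $B$ having a proper $\xi$-$\mathcal G$injective coresolution, $\xi\mathrm{xt}^n_{\mathcal{GI}(\xi)}(A,B):=H^n(\mathcal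 C(A,\mathbf H_\sharp))$; these do not depend on the choices up to isomorphism. Objects of $\mathcal{GP}^*(\xi)$ (resp. $\mathcal{GI}^*(\xi)$), defined next, do have such (co)resolutions. A $\xi$-successor of $A$ is an $\mathbb E$-triangle $K\xrightarrow{f}G\xrightarrow{g}A\dashrightarrow$ in $\xi$ such that $G\in\mathcal{GP}(\xi)$, $\xi\text{-pd}K<\infty$, it is $\mathcal C(\mathcal{GP}(\xi),-)$-exact, and $\mathcal C(g,M):\mathcal C(A,M)\to\mathcal C(G,M)$ is a monomorphism for every $M\in\mathcal{GI}(\xi)$. Dually, a $\xi$-predecessor of $B$ is an $\mathbb E$-triangle $B\xrightarrow{f}Q\xrightarrow{g}L\dashrightarrow$ in $\xi$ such that $Q\in\mathcal{GI}(\xi)$, $\xi\text{-id}L<\infty$, it is $\mathcal C(-,\mathcal{GI}(\xi))$-exact, and $\mathcal C(N,f):\mathcal C(N,B)\to\mathcal C(N,Q)$ is a monomorphism for every $N\in\mathcal{GP}(\xi)$. $\mathcal{GP}^*(\xi)$ (resp. $\mathcal{GI}^*(\xi)$) is the full subcategory of objects admitting a $\xi$-successor (resp. $\xi$-predecessor). *)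

theory Defs
  imports "HOL-Algebra.Exact_Sequence"
begin

section \<open>Extriangulated categories\<close>

text \<open>
  Abelian groups are rendered as \<^locale>\<open>comm_group\<close>s of \<open>HOL-Algebra\<close>.  Although the groups
  \<open>Hom A B\<close> and \<open>Ext C A\<close> are thought of additively, their structure is therefore written
  multiplicatively: \<open>\<otimes>\<close> is addition and \<open>\<one>\<close> is zero.

  Every morphism determines its domain and codomain, so hom-sets are disjoint.  \<open>Ext C A\<close> is the group \<open>E(C,A)\<close>, and
  \<open>emap c a\<close> is \<open>E(c,a)\<close>.  The set \<open>realize C A \<delta>\<close> is the class of sequences \<open>A \<rightarrow> B \<rightarrow> C\<close>
  assigned to \<open>\<delta>\<close>, a sequence being given by its pair of morphisms.
\<close>

record ('o, 'm) preadd =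
  Obj :: "'o set"
  Hom :: "'o \<Rightarrow> 'o \<Rightarrow> 'm monoid"
  Dom :: "'m \<Rightarrow> 'o"
  Cod :: "'m \<Rightarrow> 'o"
  Id :: "'o \<Rightarrow> 'm"
  comp :: "'m \<Rightarrow> 'm \<Rightarrow> 'm"  (infixr "\<cdot>\<index>" 75)

record ('o, 'm, 'e) extri = "('o, 'm) preadd" +
  Ext :: "'o \<Rightarrow> 'o \<Rightarrow> 'e monoid"
  emap :: "'m \<Rightarrow> 'm \<Rightarrow> 'e \<Rightarrow> 'e"
  realize :: "'o \<Rightarrow> 'o \<Rightarrow> 'e \<Rightarrow> ('m \<times> 'm) set"

abbreviation Mor :: "('o, 'm, 'z) preadd_scheme \<Rightarrow> 'o \<Rightarrow> 'o \<Rightarrow> 'm set" where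
  "Mor X A B \<equiv> carrier (Hom X A B)"


subsection \<open>Additive categories\<close>

definition zero_object :: "('o, 'm, 'z) preadd_scheme \<Rightarrow> 'o \<Rightarrow> bool" where
  "zero_object X Z \<longleftrightarrow> Z \<in> Obj X \<and>
     (\<forall>A\<in>Obj X. Mor X A Z = {\<one>\<^bsub>Hom X A Z\<^esub>} \<and> Mor X Z A = {\<one>\<^bsub>Hom X Z A\<^esub>})"

definition iso_mor :: "('o, 'm, 'z) preadd_scheme \<Rightarrow> 'o \<Rightarrow> 'o \<Rightarrow> 'm \<Rightarrow> bool" where
  "iso_mor X A B f \<longleftrightarrow> f \<in> Mor X A B \<and>
     (\<exists>g\<in>Mor X B A. g \<cdot>\<^bsub>X\<^esub> f = Id X A \<and> f \<cdot>\<^bsub>X\<^esub> g = Id X B)"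

record ('o, 'm) biprod =
  sum_obj :: 'o
  inj1 :: 'm
  inj2 :: 'm
  prj1 :: 'm
  prj2 :: 'm

definition is_biproduct ::
  "('o, 'm, 'z) preadd_scheme \<Rightarrow> 'o \<Rightarrow> 'o \<Rightarrow> ('o, 'm) biprod \<Rightarrow> bool" where
  "is_biproduct X A B S \<longleftrightarrow> A \<in> Obj X \<and> B \<in> Obj X \<and> sum_obj S \<in> Obj X \<and>
     inj1 S \<in> Mor X A (sum_obj S) \<and> inj2 S \<in> Mor X B (sum_obj S) \<and>
     prj1 S \<in> Mor X (sum_obj S) A \<and> prj2 S \<in> Mor X (sum_obj S) B \<and>
     prj1 S \<cdot>\<^bsub>X\<^esub> inj1 S = Id X A \<and> prj2 S \<cdot>\<^bsub>X\<^esub> inj2 S = Id X B \<and>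
     prj1 S \<cdot>\<^bsub>X\<^esub> inj2 S = \<one>\<^bsub>Hom X B A\<^esub> \<and> prj2 S \<cdot>\<^bsub>X\<^esub> inj1 S = \<one>\<^bsub>Hom X A B\<^esub> \<and>
     (inj1 S \<cdot>\<^bsub>X\<^esub> prj1 S) \<otimes>\<^bsub>Hom X (sum_obj S) (sum_obj S)\<^esub> (inj2 S \<cdot>\<^bsub>X\<^esub> prj2 S)
       = Id X (sum_obj S)"

locale additive_category =
  fixes X :: "('o, 'm, 'z) preadd_scheme" (structure)
  assumes MorD: "f \<in> Mor X A B \<Longrightarrow> A \<in> Obj X \<and> B \<in> Obj X \<and> Dom X f = A \<and> Cod X f = B"
    and Id_closed: "A \<in> Obj X \<Longrightarrow> Id X A \<in> Mor X A A"
    and comp_closed: "\<lbrakk>f \<in> Mor X A B; g \<in> Mor X B C\<rbrakk> \<Longrightarrow> g \<cdot> f \<in> Mor X A C"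
    and comp_assoc: "\<lbrakk>f \<in> Mor X A B; g \<in> Mor X B C; h \<in> Mor X C D\<rbrakk>
          \<Longrightarrow> (h \<cdot> g) \<cdot> f = h \<cdot> (g \<cdot> f)"
    and Id_left: "f \<in> Mor X A B \<Longrightarrow> Id X B \<cdot> f = f"
    and Id_right: "f \<in> Mor X A B \<Longrightarrow> f \<cdot> Id X A = f"
    and Hom_comm_group: "\<lbrakk>A \<in> Obj X; B \<in> Obj X\<rbrakk> \<Longrightarrow> comm_group (Hom X A B)"
    and comp_add_right: "\<lbrakk>f \<in> Mor X A B; f' \<in> Mor X A B; g \<in> Mor X B C\<rbrakk>
          \<Longrightarrow> g \<cdot> (f \<otimes>\<^bsub>Hom X A B\<^esub> f') = (g \<cdot> f) \<otimes>\<^bsub>Hom X A C\<^esub> (g \<cdot> f')"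
    and comp_add_left: "\<lbrakk>f \<in> Mor X A B; g \<in> Mor X B C; g' \<in> Mor X B C\<rbrakk>
          \<Longrightarrow> (g \<otimes>\<^bsub>Hom X B C\<^esub> g') \<cdot> f = (g \<cdot> f) \<otimes>\<^bsub>Hom X A C\<^esub> (g' \<cdot> f)"
    and ex_zero_object: "\<exists>Z. zero_object X Z"
    and ex_biproduct: "\<lbrakk>A \<in> Obj X; B \<in> Obj X\<rbrakk> \<Longrightarrow> \<exists>S. is_biproduct X A B S"


subsection \<open>Extensions and their realizations\<close>

text \<open>\<open>push X C a \<delta>\<close> is \<open>a\<^sub>* \<delta>\<close> for \<open>\<delta> \<in> E(C,A)\<close> and \<open>pull X A c \<delta>\<close> is \<open>c\<^sup>* \<delta>\<close>.\<close>

definition push :: "('o, 'm, 'e) extri \<Rightarrow> 'o \<Rightarrow> 'm \<Rightarrow> 'e \<Rightarrow> 'e" where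
  "push X C a \<delta> = emap X (Id X C) a \<delta>"

definition pull :: "('o, 'm, 'e) extri \<Rightarrow> 'o \<Rightarrow> 'm \<Rightarrow> 'e \<Rightarrow> 'e" where
  "pull X A c \<delta> = emap X c (Id X A) \<delta>"

definition seqs :: "('o, 'm, 'e) extri \<Rightarrow> 'o \<Rightarrow> 'o \<Rightarrow> ('m \<times> 'm) set" where
  "seqs X A C = {(x, y). \<exists>B. x \<in> Mor X A B \<and> y \<in> Mor X B C}"

definition seq_equiv :: "('o, 'm, 'e) extri \<Rightarrow> 'o \<Rightarrow> 'o \<Rightarrow> (('m \<times> 'm) \<times> ('m \<times> 'm)) set" where
  "seq_equiv X A C = {((x, y), (x', y')). (x, y) \<in> seqs X A C \<and> (x', y') \<in> seqs X A C \<and>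
     (\<exists>b. iso_mor X (Cod X x) (Cod X x') b \<and> b \<cdot>\<^bsub>X\<^esub> x = x' \<and> y' \<cdot>\<^bsub>X\<^esub> b = y)}"

definition etriangle ::
  "('o, 'm, 'e) extri \<Rightarrow> 'o \<Rightarrow> 'm \<Rightarrow> 'o \<Rightarrow> 'm \<Rightarrow> 'o \<Rightarrow> 'e \<Rightarrow> bool" where
  "etriangle X A x B y C \<delta> \<longleftrightarrow> x \<in> Mor X A B \<and> y \<in> Mor X B C \<and>
     \<delta> \<in> carrier (Ext X C A) \<and> (x, y) \<in> realize X C A \<delta>"

definition ext_mor ::
  "('o, 'm, 'e) extri \<Rightarrow> 'o \<Rightarrow> 'o \<Rightarrow> 'e \<Rightarrow> 'o \<Rightarrow> 'o \<Rightarrow> 'e \<Rightarrow> 'm \<Rightarrow> 'm \<Rightarrow> bool" where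
  "ext_mor X A C \<delta> A' C' \<delta>' a c \<longleftrightarrow> \<delta> \<in> carrier (Ext X C A) \<and> \<delta>' \<in> carrier (Ext X C' A') \<and>
     a \<in> Mor X A A' \<and> c \<in> Mor X C C' \<and> push X C a \<delta> = pull X A' c \<delta>'"

definition mor_sum ::
  "('o, 'm, 'e) extri \<Rightarrow> ('o, 'm) biprod \<Rightarrow> ('o, 'm) biprod \<Rightarrow> 'm \<Rightarrow> 'm \<Rightarrow> 'm" where
  "mor_sum X S T f g =
     (inj1 T \<cdot>\<^bsub>X\<^esub> f \<cdot>\<^bsub>X\<^esub> prj1 S) \<otimes>\<^bsub>Hom X (sum_obj S) (sum_obj T)\<^esub> (inj2 T \<cdot>\<^bsub>X\<^esub> g \<cdot>\<^bsub>X\<^esub> prj2 S)"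

text \<open>
  For \<open>\<delta> \<in> E(C,A)\<close> and \<open>\<delta>' \<in> E(C',A')\<close>, with biproducts \<open>S\<close> of \<open>C, C'\<close> and \<open>T\<close> of \<open>A, A'\<close>,
  the element \<open>\<delta> \<oplus> \<delta>'\<close> corresponds to \<open>(\<delta>, 0, 0, \<delta>')\<close> under the decomposition of
  \<open>E(C \<oplus> C', A \<oplus> A')\<close> given by biadditivity.
\<close>

definition ext_sum ::
  "('o, 'm, 'e) extri \<Rightarrow> ('o, 'm) biprod \<Rightarrow> ('o, 'm) biprod \<Rightarrow> 'e \<Rightarrow> 'e \<Rightarrow> 'e" where
  "ext_sum X S T \<delta> \<delta>' =
     emap X (prj1 S) (inj1 T) \<delta> \<otimes>\<^bsub>Ext X (sum_obj S) (sum_obj T)\<^esub> emap X (prj2 S) (inj2 T) \<delta>'"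

locale extriangulated_category = additive_category X
  for X :: "('o, 'm, 'e) extri" (structure) +
  assumes ExtD: "\<delta> \<in> carrier (Ext X C A) \<Longrightarrow> C \<in> Obj X \<and> A \<in> Obj X"
    and Ext_comm_group: "\<lbrakk>C \<in> Obj X; A \<in> Obj X\<rbrakk> \<Longrightarrow> comm_group (Ext X C A)"
    and emap_hom: "\<lbrakk>c \<in> Mor X C' C; a \<in> Mor X A A'\<rbrakk>
          \<Longrightarrow> emap X c a \<in> hom (Ext X C A) (Ext X C' A')"
    and emap_Id: "\<delta> \<in> carrier (Ext X C A) \<Longrightarrow> emap X (Id X C) (Id X A) \<delta> = \<delta>"
    and emap_comp: "\<lbrakk>c \<in> Mor X C' C; c' \<in> Mor X C'' C'; a \<in> Mor X A A'; a' \<in> Mor X A' A'';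
             \<delta> \<in> carrier (Ext X C A)\<rbrakk>
          \<Longrightarrow> emap X (c \<cdot> c') (a' \<cdot> a) \<delta> = emap X c' a' (emap X c a \<delta>)"
    and emap_add_left: "\<lbrakk>c \<in> Mor X C' C; c' \<in> Mor X C' C; a \<in> Mor X A A';
             \<delta> \<in> carrier (Ext X C A)\<rbrakk>
          \<Longrightarrow> emap X (c \<otimes>\<^bsub>Hom X C' C\<^esub> c') a \<delta> = emap X c a \<delta> \<otimes>\<^bsub>Ext X C' A'\<^esub> emap X c' a \<delta>"
    and emap_add_right: "\<lbrakk>c \<in> Mor X C' C; a \<in> Mor X A A'; a' \<in> Mor X A A';
             \<delta> \<in> carrier (Ext X C A)\<rbrakk>
          \<Longrightarrow> emap X c (a \<otimes>\<^bsub>Hom X A A'\<^esub> a') \<delta> = emap X c a \<delta> \<otimes>\<^bsub>Ext X C' A'\<^esub> emap X c a' \<delta>"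
    and realize_class: "\<delta> \<in> carrier (Ext X C A)
          \<Longrightarrow> realize X C A \<delta> \<in> seqs X A C // seq_equiv X A C"
    and ET2_mor: "\<lbrakk>etriangle X A x B y C \<delta>; etriangle X A' x' B' y' C' \<delta>';
             ext_mor X A C \<delta> A' C' \<delta>' a c\<rbrakk>
          \<Longrightarrow> \<exists>b\<in>Mor X B B'. b \<cdot> x = x' \<cdot> a \<and> y' \<cdot> b = c \<cdot> y"
    and ET2_zero: "is_biproduct X A C S
          \<Longrightarrow> (inj1 S, prj2 S) \<in> realize X C A \<one>\<^bsub>Ext X C A\<^esub>"
    and ET2_sum: "\<lbrakk>etriangle X A x B y C \<delta>; etriangle X A' x' B' y' C' \<delta>';
             is_biproduct X A A' S; is_biproduct X B B' T; is_biproduct X C C' U\<rbrakk>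
          \<Longrightarrow> (mor_sum X S T x x', mor_sum X T U y y')
                \<in> realize X (sum_obj U) (sum_obj S) (ext_sum X U S \<delta> \<delta>')"
    and ET3: "\<lbrakk>etriangle X A x B y C \<delta>; etriangle X A' x' B' y' C' \<delta>';
             a \<in> Mor X A A'; b \<in> Mor X B B'; b \<cdot> x = x' \<cdot> a\<rbrakk>
          \<Longrightarrow> \<exists>c\<in>Mor X C C'. c \<cdot> y = y' \<cdot> b \<and> ext_mor X A C \<delta> A' C' \<delta>' a c"
    and ET3_op: "\<lbrakk>etriangle X A x B y C \<delta>; etriangle X A' x' B' y' C' \<delta>';
             b \<in> Mor X B B'; c \<in> Mor X C C'; c \<cdot> y = y' \<cdot> b\<rbrakk>
          \<Longrightarrow> \<exists>a\<in>Mor X A A'. b \<cdot> x = x' \<cdot> a \<and> ext_mor X A C \<delta> A' C' \<delta>' a c"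
    and ET4: "\<lbrakk>etriangle X A f B f' D \<delta>; etriangle X B g C g' F \<delta>'\<rbrakk>
          \<Longrightarrow> \<exists>E h' d e \<delta>''. etriangle X A (g \<cdot> f) C h' E \<delta>'' \<and>
                etriangle X D d E e F (push X F f' \<delta>') \<and>
                h' \<cdot> g = d \<cdot> f' \<and> e \<cdot> h' = g' \<and>
                pull X A d \<delta>'' = \<delta> \<and> push X E f \<delta>'' = pull X B e \<delta>'"
    and ET4_op: "\<lbrakk>etriangle X D f' B f A \<delta>; etriangle X F g' C g B \<delta>'\<rbrakk>
          \<Longrightarrow> \<exists>E h' d e \<delta>''. etriangle X E h' C (f \<cdot> g) A \<delta>'' \<and>
                etriangle X F e E d D (pull X F f' \<delta>') \<and>
                g \<cdot> h' = f' \<cdot> d \<and> h' \<cdot> e = g' \<and>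
                push X A d \<delta>'' = \<delta> \<and> pull X E f \<delta>'' = push X B e \<delta>'"

definition inflation :: "('o, 'm, 'e) extri \<Rightarrow> 'm \<Rightarrow> bool" where
  "inflation X x \<longleftrightarrow> (\<exists>A B y C \<delta>. etriangle X A x B y C \<delta>)"

definition deflation :: "('o, 'm, 'e) extri \<Rightarrow> 'm \<Rightarrow> bool" where
  "deflation X y \<longleftrightarrow> (\<exists>A x B C \<delta>. etriangle X A x B y C \<delta>)"

definition WIC :: "('o, 'm, 'e) extri \<Rightarrow> bool" where
  "WIC X \<longleftrightarrow> (\<forall>A B C f g. f \<in> Mor X A B \<and> g \<in> Mor X B C \<longrightarrow>
     (inflation X (g \<cdot>\<^bsub>X\<^esub> f) \<longrightarrow> inflation X f) \<and>
     (deflation X (g \<cdot>\<^bsub>X\<^esub> f) \<longrightarrow> deflation X g))"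


section \<open>Proper classes\<close>

text \<open>
  A class \<open>\<xi>\<close> of \<open>E\<close>-triangles is a set of triples \<open>(x, y, \<delta>)\<close>; the three objects are
  recovered from \<open>x\<close> and \<open>y\<close>.
\<close>

definition tri_in ::
  "('o, 'm, 'e) extri \<Rightarrow> ('m \<times> 'm \<times> 'e) set \<Rightarrow> 'o \<Rightarrow> 'm \<Rightarrow> 'o \<Rightarrow> 'm \<Rightarrow> 'o \<Rightarrow> 'e \<Rightarrow> bool" where
  "tri_in X \<xi> A x B y C \<delta> \<longleftrightarrow> etriangle X A x B y C \<delta> \<and> (x, y, \<delta>) \<in> \<xi>"

locale proper_class = extriangulated_category X
  for X :: "('o, 'm, 'e) extri" (structure) and \<xi> :: "('m \<times> 'm \<times> 'e) set" +
  assumes etriangles: "(x, y, \<delta>) \<in> \<xi> \<Longrightarrow> \<exists>A B C. etriangle X A x B y C \<delta>"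
    and iso_closed: "\<lbrakk>tri_in X \<xi> A x B y C \<delta>; etriangle X A' x' B' y' C' \<delta>';
             iso_mor X A A' a; iso_mor X B B' b; iso_mor X C C' c;
             b \<cdot> x = x' \<cdot> a; c \<cdot> y = y' \<cdot> b; ext_mor X A C \<delta> A' C' \<delta>' a c\<rbrakk>
          \<Longrightarrow> tri_in X \<xi> A' x' B' y' C' \<delta>'"
    and split_in: "etriangle X A x B y C \<one>\<^bsub>Ext X C A\<^esub> \<Longrightarrow> tri_in X \<xi> A x B y C \<one>\<^bsub>Ext X C A\<^esub>"
    and sum_closed: "\<lbrakk>tri_in X \<xi> A x B y C \<delta>; tri_in X \<xi> A' x' B' y' C' \<delta>';
             is_biproduct X A A' S; is_biproduct X B B' T; is_biproduct X C C' U\<rbrakk>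
          \<Longrightarrow> tri_in X \<xi> (sum_obj S) (mor_sum X S T x x') (sum_obj T) (mor_sum X T U y y')
                (sum_obj U) (ext_sum X U S \<delta> \<delta>')"
    and base_change: "\<lbrakk>tri_in X \<xi> A x B y C \<delta>; c \<in> Mor X C' C;
             etriangle X A x' B' y' C' (pull X A c \<delta>)\<rbrakk>
          \<Longrightarrow> tri_in X \<xi> A x' B' y' C' (pull X A c \<delta>)"
    and cobase_change: "\<lbrakk>tri_in X \<xi> A x B y C \<delta>; a \<in> Mor X A A';
             etriangle X A' x' B' y' C (push X C a \<delta>)\<rbrakk>
          \<Longrightarrow> tri_in X \<xi> A' x' B' y' C (push X C a \<delta>)"
    and saturated: "\<lbrakk>etriangle X A\<^sub>1 x\<^sub>1 B\<^sub>1 y\<^sub>1 C \<delta>\<^sub>1; tri_in X \<xi> A\<^sub>2 x\<^sub>2 B\<^sub>2 y\<^sub>2 C \<delta>\<^sub>2;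
             tri_in X \<xi> A\<^sub>1 m M n B\<^sub>2 (pull X A\<^sub>1 y\<^sub>2 \<delta>\<^sub>1)\<rbrakk>
          \<Longrightarrow> tri_in X \<xi> A\<^sub>1 x\<^sub>1 B\<^sub>1 y\<^sub>1 C \<delta>\<^sub>1"


subsection \<open>Exactness, projectives and injectives\<close>

text \<open>
  The library's \<^const>\<open>short_exact_sequence\<close> lists groups and maps from right to left:
  \<open>short_exact_sequence G\<^sub>3 G\<^sub>2 G\<^sub>1 g f\<close> says that \<open>0 \<rightarrow> G\<^sub>1 \<rightarrow> G\<^sub>2 \<rightarrow> G\<^sub>3 \<rightarrow> 0\<close>, with maps \<open>f\<close> and
  \<open>g\<close>, is exact.
\<close>

definition cov_exact ::
  "('o, 'm, 'e) extri \<Rightarrow> 'o set \<Rightarrow> 'o \<Rightarrow> 'm \<Rightarrow> 'o \<Rightarrow> 'm \<Rightarrow> 'o \<Rightarrow> bool" where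
  "cov_exact X \<W> A x B y C \<longleftrightarrow> (\<forall>W\<in>\<W>.
     short_exact_sequence (Hom X W C) (Hom X W B) (Hom X W A) (\<lambda>h. y \<cdot>\<^bsub>X\<^esub> h) (\<lambda>h. x \<cdot>\<^bsub>X\<^esub> h))"

definition contra_exact ::
  "('o, 'm, 'e) extri \<Rightarrow> 'o set \<Rightarrow> 'o \<Rightarrow> 'm \<Rightarrow> 'o \<Rightarrow> 'm \<Rightarrow> 'o \<Rightarrow> bool" where
  "contra_exact X \<W> A x B y C \<longleftrightarrow> (\<forall>W\<in>\<W>.
     short_exact_sequence (Hom X A W) (Hom X B W) (Hom X C W) (\<lambda>h. h \<cdot>\<^bsub>X\<^esub> x) (\<lambda>h. h \<cdot>\<^bsub>X\<^esub> y))"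

definition Proj :: "('o, 'm, 'e) extri \<Rightarrow> ('m \<times> 'm \<times> 'e) set \<Rightarrow> 'o set" where
  "Proj X \<xi> = {P \<in> Obj X. \<forall>A x B y C \<delta>. tri_in X \<xi> A x B y C \<delta> \<longrightarrow> cov_exact X {P} A x B y C}"

definition Inj :: "('o, 'm, 'e) extri \<Rightarrow> ('m \<times> 'm \<times> 'e) set \<Rightarrow> 'o set" where
  "Inj X \<xi> = {I \<in> Obj X. \<forall>A x B y C \<delta>. tri_in X \<xi> A x B y C \<delta> \<longrightarrow> contra_exact X {I} A x B y C}"

definition enough_projectives :: "('o, 'm, 'e) extri \<Rightarrow> ('m \<times> 'm \<times> 'e) set \<Rightarrow> bool" where
  "enough_projectives X \<xi> \<longleftrightarrow>
     (\<forall>A\<in>Obj X. \<exists>K x P y \<delta>. tri_in X \<xi> K x P y A \<delta> \<and> P \<in> Proj X \<xi>)"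

definition enough_injectives :: "('o, 'm, 'e) extri \<Rightarrow> ('m \<times> 'm \<times> 'e) set \<Rightarrow> bool" where
  "enough_injectives X \<xi> \<longleftrightarrow>
     (\<forall>A\<in>Obj X. \<exists>x I y L \<delta>. tri_in X \<xi> A x I y L \<delta> \<and> I \<in> Inj X \<xi>)"

text \<open>\<open>pd_le X \<xi> n A\<close> means \<open>\<xi>-pd A \<le> n\<close>, where \<open>n \<ge> -1\<close> is an integer.\<close>

inductive pd_le :: "('o, 'm, 'e) extri \<Rightarrow> ('m \<times> 'm \<times> 'e) set \<Rightarrow> int \<Rightarrow> 'o \<Rightarrow> bool"
  for X \<xi> where
  zero: "zero_object X A \<Longrightarrow> pd_le X \<xi> (-1) A"
| proj: "A \<in> Proj X \<xi> \<Longrightarrow> pd_le X \<xi> 0 A"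
| step: "\<lbrakk>tri_in X \<xi> K x P y A \<delta>; P \<in> Proj X \<xi>; pd_le X \<xi> (n - 1) K\<rbrakk> \<Longrightarrow> pd_le X \<xi> n A"

inductive id_le :: "('o, 'm, 'e) extri \<Rightarrow> ('m \<times> 'm \<times> 'e) set \<Rightarrow> int \<Rightarrow> 'o \<Rightarrow> bool"
  for X \<xi> where
  zero: "zero_object X A \<Longrightarrow> id_le X \<xi> (-1) A"
| inj: "A \<in> Inj X \<xi> \<Longrightarrow> id_le X \<xi> 0 A"
| step: "\<lbrakk>tri_in X \<xi> A x I y L \<delta>; I \<in> Inj X \<xi>; id_le X \<xi> (n - 1) L\<rbrakk> \<Longrightarrow> id_le X \<xi> n A"

definition pd_finite :: "('o, 'm, 'e) extri \<Rightarrow> ('m \<times> 'm \<times> 'e) set \<Rightarrow> 'o \<Rightarrow> bool" where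
  "pd_finite X \<xi> A \<longleftrightarrow> (\<exists>n. pd_le X \<xi> n A)"

definition id_finite :: "('o, 'm, 'e) extri \<Rightarrow> ('m \<times> 'm \<times> 'e) set \<Rightarrow> 'o \<Rightarrow> bool" where
  "id_finite X \<xi> A \<longleftrightarrow> (\<exists>n. id_le X \<xi> n A)"


section \<open>Gorenstein projective and Gorenstein injective objects\<close>

definition xi_exact_complex ::
  "('o, 'm, 'e) extri \<Rightarrow> ('m \<times> 'm \<times> 'e) set \<Rightarrow> (int \<Rightarrow> 'o) \<Rightarrow> (int \<Rightarrow> 'm) \<Rightarrow>
   (int \<Rightarrow> 'o) \<Rightarrow> (int \<Rightarrow> 'm) \<Rightarrow> (int \<Rightarrow> 'm) \<Rightarrow> (int \<Rightarrow> 'e) \<Rightarrow> bool" where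
  "xi_exact_complex X \<xi> V d K g f \<delta> \<longleftrightarrow>
     (\<forall>n. tri_in X \<xi> (K (n + 1)) (g n) (V n) (f n) (K n) (\<delta> n) \<and> d n = g (n - 1) \<cdot>\<^bsub>X\<^esub> f n)"

definition complete_proj_resolution ::
  "('o, 'm, 'e) extri \<Rightarrow> ('m \<times> 'm \<times> 'e) set \<Rightarrow> (int \<Rightarrow> 'o) \<Rightarrow> (int \<Rightarrow> 'm) \<Rightarrow>
   (int \<Rightarrow> 'o) \<Rightarrow> (int \<Rightarrow> 'm) \<Rightarrow> (int \<Rightarrow> 'm) \<Rightarrow> (int \<Rightarrow> 'e) \<Rightarrow> bool" where
  "complete_proj_resolution X \<xi> V d K g f \<delta> \<longleftrightarrow> xi_exact_complex X \<xi> V d K g f \<delta> \<and>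
     (\<forall>n. V n \<in> Proj X \<xi> \<and> contra_exact X (Proj X \<xi>) (K (n + 1)) (g n) (V n) (f n) (K n))"

definition complete_inj_coresolution ::
  "('o, 'm, 'e) extri \<Rightarrow> ('m \<times> 'm \<times> 'e) set \<Rightarrow> (int \<Rightarrow> 'o) \<Rightarrow> (int \<Rightarrow> 'm) \<Rightarrow>
   (int \<Rightarrow> 'o) \<Rightarrow> (int \<Rightarrow> 'm) \<Rightarrow> (int \<Rightarrow> 'm) \<Rightarrow> (int \<Rightarrow> 'e) \<Rightarrow> bool" where
  "complete_inj_coresolution X \<xi> V d K g f \<delta> \<longleftrightarrow> xi_exact_complex X \<xi> V d K g f \<delta> \<and>
     (\<forall>n. V n \<in> Inj X \<xi> \<and> cov_exact X (Inj X \<xi>) (K (n + 1)) (g n) (V n) (f n) (K n))"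

definition GP :: "('o, 'm, 'e) extri \<Rightarrow> ('m \<times> 'm \<times> 'e) set \<Rightarrow> 'o set" where
  "GP X \<xi> = {K n | V d K g f \<delta> n. complete_proj_resolution X \<xi> V d K g f \<delta>}"

definition GI :: "('o, 'm, 'e) extri \<Rightarrow> ('m \<times> 'm \<times> 'e) set \<Rightarrow> 'o set" where
  "GI X \<xi> = {K n | V d K g f \<delta> n. complete_inj_coresolution X \<xi> V d K g f \<delta>}"

definition is_successor ::
  "('o, 'm, 'e) extri \<Rightarrow> ('m \<times> 'm \<times> 'e) set \<Rightarrow> 'o \<Rightarrow> 'm \<Rightarrow> 'o \<Rightarrow> 'm \<Rightarrow> 'o \<Rightarrow> 'e \<Rightarrow> bool" where
  "is_successor X \<xi> K f G g A \<delta> \<longleftrightarrow> tri_in X \<xi> K f G g A \<delta> \<and> G \<in> GP X \<xi> \<and> pd_finite X \<xi> K \<and>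
     cov_exact X (GP X \<xi>) K f G g A \<and>
     (\<forall>M\<in>GI X \<xi>. (\<lambda>h. h \<cdot>\<^bsub>X\<^esub> g) \<in> mon (Hom X A M) (Hom X G M))"

definition is_predecessor ::
  "('o, 'm, 'e) extri \<Rightarrow> ('m \<times> 'm \<times> 'e) set \<Rightarrow> 'o \<Rightarrow> 'm \<Rightarrow> 'o \<Rightarrow> 'm \<Rightarrow> 'o \<Rightarrow> 'e \<Rightarrow> bool" where
  "is_predecessor X \<xi> B f Q g L \<delta> \<longleftrightarrow> tri_in X \<xi> B f Q g L \<delta> \<and> Q \<in> GI X \<xi> \<and> id_finite X \<xi> L \<and>
     contra_exact X (GI X \<xi>) B f Q g L \<and>
     (\<forall>N\<in>GP X \<xi>. (\<lambda>h. f \<cdot>\<^bsub>X\<^esub> h) \<in> mon (Hom X N B) (Hom X N Q))"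

definition GP_star :: "('o, 'm, 'e) extri \<Rightarrow> ('m \<times> 'm \<times> 'e) set \<Rightarrow> 'o set" where
  "GP_star X \<xi> = {A \<in> Obj X. \<exists>K f G g \<delta>. is_successor X \<xi> K f G g A \<delta>}"

definition GI_star :: "('o, 'm, 'e) extri \<Rightarrow> ('m \<times> 'm \<times> 'e) set \<Rightarrow> 'o set" where
  "GI_star X \<xi> = {B \<in> Obj X. \<exists>f Q g L \<delta>. is_predecessor X \<xi> B f Q g L \<delta>}"


section \<open>Relative cohomology\<close>

text \<open>
  A proper resolution of \<open>A\<close> is given by its objects \<open>G i\<close> and its differentials, where
  \<open>d 0 : G 0 \<rightarrow> A\<close> is the augmentation and \<open>d (Suc i) : G (Suc i) \<rightarrow> G i\<close>.  Dually, for a proper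
  coresolution \<open>d 0 : B \<rightarrow> H 0\<close> and \<open>d (Suc i) : H i \<rightarrow> H (Suc i)\<close>.
\<close>

definition proper_GP_resolution ::
  "('o, 'm, 'e) extri \<Rightarrow> ('m \<times> 'm \<times> 'e) set \<Rightarrow> 'o \<Rightarrow> (nat \<Rightarrow> 'o) \<Rightarrow> (nat \<Rightarrow> 'm) \<Rightarrow> bool" where
  "proper_GP_resolution X \<xi> A G d \<longleftrightarrow> (\<forall>i. G i \<in> GP X \<xi>) \<and>
     (\<exists>K g f \<delta>. K 0 = A \<and>
        (\<forall>i. tri_in X \<xi> (K (Suc i)) (g i) (G i) (f i) (K i) (\<delta> i) \<and>
             cov_exact X (GP X \<xi>) (K (Suc i)) (g i) (G i) (f i) (K i)) \<and>
        d 0 = f 0 \<and> (\<forall>i. d (Suc i) = g i \<cdot>\<^bsub>X\<^esub> f (Suc i)))"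

definition proper_GI_coresolution ::
  "('o, 'm, 'e) extri \<Rightarrow> ('m \<times> 'm \<times> 'e) set \<Rightarrow> 'o \<Rightarrow> (nat \<Rightarrow> 'o) \<Rightarrow> (nat \<Rightarrow> 'm) \<Rightarrow> bool" where
  "proper_GI_coresolution X \<xi> B H d \<longleftrightarrow> (\<forall>i. H i \<in> GI X \<xi>) \<and>
     (\<exists>K g f \<delta>. K 0 = B \<and>
        (\<forall>i. tri_in X \<xi> (K i) (g i) (H i) (f i) (K (Suc i)) (\<delta> i) \<and>
             contra_exact X (GI X \<xi>) (K i) (g i) (H i) (f i) (K (Suc i))) \<and>
        d 0 = g 0 \<and> (\<forall>i. d (Suc i) = g (Suc i) \<cdot>\<^bsub>X\<^esub> f i))"

text \<open>Cohomology of a cochain complex \<open>0 \<rightarrow> V 0 \<rightarrow> V 1 \<rightarrow> \<dots>\<close> with differentials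
  \<open>d i : V i \<rightarrow> V (Suc i)\<close>.\<close>

definition cohomology :: "(nat \<Rightarrow> 'a monoid) \<Rightarrow> (nat \<Rightarrow> 'a \<Rightarrow> 'a) \<Rightarrow> nat \<Rightarrow> 'a set monoid" where
  "cohomology V d n =
     (V n)\<lparr>carrier := kernel (V n) (V (Suc n)) (d n)\<rparr>
       Mod (case n of 0 \<Rightarrow> {\<one>\<^bsub>V 0\<^esub>} | Suc m \<Rightarrow> d m ` carrier (V m))"

text \<open>
  The cohomology groups depend on the (co)resolution only up to isomorphism, so some
  (co)resolution is chosen.  It depends neither on the other argument nor on \<open>n\<close>.
\<close>

definition the_GP_resolution ::
  "('o, 'm, 'e) extri \<Rightarrow> ('m \<times> 'm \<times> 'e) set \<Rightarrow> 'o \<Rightarrow> (nat \<Rightarrow> 'o) \<times> (nat \<Rightarrow> 'm)" where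
  "the_GP_resolution X \<xi> A = (SOME (G, d). proper_GP_resolution X \<xi> A G d)"

definition the_GI_coresolution ::
  "('o, 'm, 'e) extri \<Rightarrow> ('m \<times> 'm \<times> 'e) set \<Rightarrow> 'o \<Rightarrow> (nat \<Rightarrow> 'o) \<times> (nat \<Rightarrow> 'm)" where
  "the_GI_coresolution X \<xi> B = (SOME (H, d). proper_GI_coresolution X \<xi> B H d)"

definition xt_GP ::
  "('o, 'm, 'e) extri \<Rightarrow> ('m \<times> 'm \<times> 'e) set \<Rightarrow> nat \<Rightarrow> 'o \<Rightarrow> 'o \<Rightarrow> 'm set monoid" where
  "xt_GP X \<xi> n A B = (let (G, d) = the_GP_resolution X \<xi> A in
     cohomology (\<lambda>i. Hom X (G i) B) (\<lambda>i u. u \<cdot>\<^bsub>X\<^esub> d (Suc i)) n)"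

definition xt_GI ::
  "('o, 'm, 'e) extri \<Rightarrow> ('m \<times> 'm \<times> 'e) set \<Rightarrow> nat \<Rightarrow> 'o \<Rightarrow> 'o \<Rightarrow> 'm set monoid" where
  "xt_GI X \<xi> n A B = (let (H, d) = the_GI_coresolution X \<xi> B in
     cohomology (\<lambda>i. Hom X A (H i)) (\<lambda>i u. d (Suc i) \<cdot>\<^bsub>X\<^esub> u) n)"

end

(*
  A successor K -> G -> A followed by a projective resolution of K is a proper Gorenstein projective
  resolution of A: since K has finite projective dimension, dimension shifting along the complete
  resolutions shows that the resolution triangles of K are exact both under C(GP,-) and under
  C(-,GI).  By the comparison theorem every proper resolution G. of A then stays exact under
  C(-,M) for M in GI, and dually for proper coresolutions H. of B.  Hence in the augmented double
  complex C(G_i,H_j) all rows and columns are exact except the two edges C(G_i,B) and C(A,H_j),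
  whose cohomologies are therefore isomorphic.  The injective half of the argument is the projective half
  in the opposite category.
*)

theory Submission
  imports Defs
begin

section \<open>Opposite categories\<close>

text \<open>No long exact sequence of extension groups is set up. Its place is taken by one
  observation: in a morphism of extensions \<open>(a, c)\<close>, the map \<open>a\<close> extends
  along the inflation of the first triangle iff \<open>c\<close> lifts along the deflation of the
  second, because the two obstructions are the same element. Dimension shifting thus becomes an
  exchange of extension and lifting properties between two triangles, one cut out of a complete
  (co)resolution, the other out of a finite projective resolution. Hom sequences of a triangle are
  always exact in the middle, so every exactness claim splits into an injectivity and a surjectivity
  claim that travel separately. Injectivity under C(-,M) for M in GI is the delicate one: it also
  uses finite dimension of the third object, which A need not have, and at the first triangle it
  comes from the monomorphism condition on a successor. The edges of the double complex are compared
  without a total complex or spectral sequence, by moving along an antidiagonal one square at a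
  time.\<close>

definition op_cat :: "('o, 'm, 'e) extri \<Rightarrow> ('o, 'm, 'e) extri" where
  "op_cat X = \<lparr>Obj = Obj X, Hom = (\<lambda>A B. Hom X B A), Dom = Cod X, Cod = Dom X, Id = Id X,
     comp = (\<lambda>g f. f \<cdot>\<^bsub>X\<^esub> g), Ext = (\<lambda>C A. Ext X A C), emap = (\<lambda>c a. emap X a c),
     realize = (\<lambda>C A \<delta>. {(y, x). (x, y) \<in> realize X A C \<delta>})\<rparr>"

definition op_class :: "('m \<times> 'm \<times> 'e) set \<Rightarrow> ('m \<times> 'm \<times> 'e) set" where
  "op_class \<xi> = {(y, x, \<delta>). (x, y, \<delta>) \<in> \<xi>}"

lemma op_cat_simps [simp]:
  "Obj (op_cat X) = Obj X" "Hom (op_cat X) A B = Hom X B A" "Dom (op_cat X) = Cod X"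
  "Cod (op_cat X) = Dom X" "Id (op_cat X) = Id X" "g \<cdot>\<^bsub>op_cat X\<^esub> f = f \<cdot>\<^bsub>X\<^esub> g"
  by (simp_all add: op_cat_def)

lemma op_cat_op_cat [simp]: "op_cat (op_cat X) = X"
  by (simp add: op_cat_def)

lemma op_class_op_class [simp]: "op_class (op_class \<xi>) = \<xi>"
  by (auto simp: op_class_def)

text \<open>The single place where realizations in the opposite category are unfolded; later duality
  arguments see triangles only through \<open>tri_in\<close>.\<close>

lemma tri_in_op_cat [simp]:
  "tri_in (op_cat X) (op_class \<xi>) C y B x A \<delta> \<longleftrightarrow> tri_in X \<xi> A x B y C \<delta>"
  by (auto simp: tri_in_def etriangle_def op_cat_def op_class_def)

lemma zero_object_op_cat [simp]: "zero_object (op_cat X) Z \<longleftrightarrow> zero_object X Z"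
  by (auto simp: zero_object_def)

lemma contra_exact_op_cat [simp]:
  "contra_exact (op_cat X) \<W> C y B x A \<longleftrightarrow> cov_exact X \<W> A x B y C"
  by (simp add: contra_exact_def cov_exact_def)

lemma cov_exact_op_cat [simp]:
  "cov_exact (op_cat X) \<W> C y B x A \<longleftrightarrow> contra_exact X \<W> A x B y C"
  by (simp add: contra_exact_def cov_exact_def)

lemma Proj_op_cat [simp]: "Proj (op_cat X) (op_class \<xi>) = Inj X \<xi>"
  unfolding Proj_def Inj_def by simp blast

lemma id_le_imp_pd_le_op_cat: "id_le X \<xi> n A \<Longrightarrow> pd_le (op_cat X) (op_class \<xi>) n A"
proof (induction rule: id_le.induct)
  case (step A x I y L \<delta> n)
  then show ?case
    by (auto intro: pd_le.step[where x = y and y = x])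
qed (auto intro: pd_le.intros)

lemma id_finite_imp_pd_finite_op_cat: "id_finite X \<xi> A \<Longrightarrow> pd_finite (op_cat X) (op_class \<xi>) A"
  by (auto simp: pd_finite_def id_finite_def intro: id_le_imp_pd_le_op_cat)

text \<open>The resolution triangles are indexed by descending integers in both kinds of resolution, so
  passing to the opposite category reverses the index.\<close>

lemma complete_resolution_op_cat:
  "complete_proj_resolution (op_cat X) (op_class \<xi>) V d K g f \<delta> \<longleftrightarrow>
   complete_inj_coresolution X \<xi> (\<lambda>n. V (- n)) (\<lambda>n. d (1 - n)) (\<lambda>n. K (1 - n))
     (\<lambda>n. f (- n)) (\<lambda>n. g (- n)) (\<lambda>n. \<delta> (- n))"
  (is "?L \<longleftrightarrow> ?R")
proof -
  have neg: "(\<forall>n::int. P n) \<longleftrightarrow> (\<forall>n. P (- n))" for P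
  proof (intro iffI allI)
    fix n assume "\<forall>n. P (- n)"
    then have "P (- (- n))" by blast
    then show "P n" by simp
  qed blast
  have shift: "(\<forall>n::int. P n) \<longleftrightarrow> (\<forall>n. P (1 - n))" for P
  proof (intro iffI allI)
    fix n assume "\<forall>n. P (1 - n)"
    then have "P (1 - (1 - n))" by blast
    then show "P n" by simp
  qed blast
  have "?L \<longleftrightarrow> (\<forall>n. tri_in X \<xi> (K n) (f n) (V n) (g n) (K (n + 1)) (\<delta> n)) \<and>
      (\<forall>n. d n = f n \<cdot>\<^bsub>X\<^esub> g (n - 1)) \<and>
      (\<forall>n. V n \<in> Inj X \<xi> \<and> cov_exact X (Inj X \<xi>) (K n) (f n) (V n) (g n) (K (n + 1)))"
    by (auto simp: complete_proj_resolution_def xi_exact_complex_def)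
  also have "\<dots> \<longleftrightarrow> (\<forall>n. tri_in X \<xi> (K (- n)) (f (- n)) (V (- n)) (g (- n)) (K (- n + 1)) (\<delta> (- n))) \<and>
      (\<forall>n. d (1 - n) = f (1 - n) \<cdot>\<^bsub>X\<^esub> g (1 - n - 1)) \<and>
      (\<forall>n. V (- n) \<in> Inj X \<xi> \<and>
        cov_exact X (Inj X \<xi>) (K (- n)) (f (- n)) (V (- n)) (g (- n)) (K (- n + 1)))"
    \<comment> \<open>Triangles and exactness are reflected by \<open>n\<close> to
      \<open>- n\<close>, the differentials by \<open>n\<close> to \<open>1 - n\<close>:
      \<open>d n\<close> joins the degrees \<open>n\<close> and \<open>n - 1\<close>, whose order is
      reversed by the reflection.\<close>
    by (subst (1 3) neg, subst (1) shift) (rule refl)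
  also have "\<dots> \<longleftrightarrow> ?R"
    by (auto simp: complete_inj_coresolution_def xi_exact_complex_def)
  finally show ?thesis .
qed

lemma GP_I: "complete_proj_resolution X \<xi> V d K g f \<delta> \<Longrightarrow> K n \<in> GP X \<xi>"
  unfolding GP_def by blast

lemma GI_I: "complete_inj_coresolution X \<xi> V d K g f \<delta> \<Longrightarrow> K n \<in> GI X \<xi>"
  unfolding GI_def by blast

lemma GP_op_cat_subset: "GP (op_cat X) (op_class \<xi>) \<subseteq> GI X \<xi>"
proof
  fix A assume "A \<in> GP (op_cat X) (op_class \<xi>)"
  then obtain V d K g f \<delta> n where A: "A = K n"
    and R: "complete_inj_coresolution X \<xi> (\<lambda>n. V (- n)) (\<lambda>n. d (1 - n)) (\<lambda>n. K (1 - n))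
      (\<lambda>n. f (- n)) (\<lambda>n. g (- n)) (\<lambda>n. \<delta> (- n))"
    unfolding GP_def complete_resolution_op_cat by blast
  from GI_I[OF R, of "1 - n"] A show "A \<in> GI X \<xi>" by simp
qed

lemma GI_subset_GP_op_cat: "GI X \<xi> \<subseteq> GP (op_cat X) (op_class \<xi>)"
proof
  fix A assume "A \<in> GI X \<xi>"
  then obtain V d K g f \<delta> n where A: "A = K n"
    and "complete_inj_coresolution X \<xi> V d K g f \<delta>"
    unfolding GI_def by blast
  then have R: "complete_proj_resolution (op_cat X) (op_class \<xi>) (\<lambda>n. V (- n)) (\<lambda>n. d (1 - n))
      (\<lambda>n. K (1 - n)) (\<lambda>n. f (- n)) (\<lambda>n. g (- n)) (\<lambda>n. \<delta> (- n))"
    \<comment> \<open>Both reflections are involutions, so unfolding gives back the coresolution at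
      hand.\<close>
    unfolding complete_resolution_op_cat by simp
  from GP_I[OF R, of "1 - n"] A show "A \<in> GP (op_cat X) (op_class \<xi>)" by simp
qed

lemma GP_op_cat [simp]: "GP (op_cat X) (op_class \<xi>) = GI X \<xi>"
  by (intro equalityI GP_op_cat_subset GI_subset_GP_op_cat)

lemma GI_op_cat [simp]: "GI (op_cat X) (op_class \<xi>) = GP X \<xi>"
  using GP_op_cat[of "op_cat X" "op_class \<xi>"] by simp

lemma is_predecessor_op_cat:
  "is_predecessor X \<xi> B f Q g L \<delta> \<Longrightarrow> is_successor (op_cat X) (op_class \<xi>) L g Q f B \<delta>"
  by (simp add: is_predecessor_def is_successor_def id_finite_imp_pd_finite_op_cat)

lemma GI_star_op_cat: "B \<in> GI_star X \<xi> \<Longrightarrow> B \<in> GP_star (op_cat X) (op_class \<xi>)"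
  unfolding GI_star_def GP_star_def mem_Collect_eq op_cat_simps
  by (elim conjE exE, intro conjI exI, assumption, erule is_predecessor_op_cat)

lemma proper_GP_resolution_op_cat:
  "proper_GP_resolution (op_cat X) (op_class \<xi>) B H d \<longleftrightarrow> proper_GI_coresolution X \<xi> B H d"
  (is "?L \<longleftrightarrow> ?R")
proof
  assume ?L
  then obtain K g f \<delta> where "\<forall>i. H i \<in> GI X \<xi>" "K 0 = B"
    "\<forall>i. tri_in X \<xi> (K i) (f i) (H i) (g i) (K (Suc i)) (\<delta> i) \<and>
      contra_exact X (GI X \<xi>) (K i) (f i) (H i) (g i) (K (Suc i))"
    "d 0 = f 0" "\<forall>i. d (Suc i) = f (Suc i) \<cdot>\<^bsub>X\<^esub> g i"
    by (auto simp: proper_GP_resolution_def)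
  then show ?R unfolding proper_GI_coresolution_def
    by - (rule conjI, assumption, rule exI[of _ K], rule exI[of _ f], rule exI[of _ g],
        rule exI[of _ \<delta>], simp)
next
  assume ?R
  then obtain K g f \<delta> where "\<forall>i. H i \<in> GI X \<xi>" "K 0 = B"
    "\<forall>i. tri_in X \<xi> (K i) (g i) (H i) (f i) (K (Suc i)) (\<delta> i) \<and>
      contra_exact X (GI X \<xi>) (K i) (g i) (H i) (f i) (K (Suc i))"
    "d 0 = g 0" "\<forall>i. d (Suc i) = g (Suc i) \<cdot>\<^bsub>X\<^esub> f i"
    unfolding proper_GI_coresolution_def by blast
  then show ?L unfolding proper_GP_resolution_def
    by - (rule conjI, simp, rule exI[of _ K], rule exI[of _ f], rule exI[of _ g],
        rule exI[of _ \<delta>], simp)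
qed

section \<open>Additivity of the opposite category\<close>

lemma is_biproduct_op_cat:
  assumes "is_biproduct X A B S"
  shows "is_biproduct (op_cat X) A B
    \<lparr>sum_obj = sum_obj S, inj1 = prj1 S, inj2 = prj2 S, prj1 = inj1 S, prj2 = inj2 S\<rparr>"
  using assms by (auto simp: is_biproduct_def)

lemma additive_category_op_cat:
  assumes "additive_category X"
  shows "additive_category (op_cat X)"
proof -
  interpret additive_category X by (rule assms)
  show ?thesis
  proof (rule additive_category.intro)
    show "\<exists>Z. zero_object (op_cat X) Z" using ex_zero_object by simp
    show "\<exists>S. is_biproduct (op_cat X) A B S" if "A \<in> Obj (op_cat X)" "B \<in> Obj (op_cat X)" for A B
      using that ex_biproduct[of A B] is_biproduct_op_cat by fastforce
  next
    fix f A B assume "f \<in> Mor (op_cat X) A B"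
    then show "A \<in> Obj (op_cat X) \<and> B \<in> Obj (op_cat X) \<and> Dom (op_cat X) f = A \<and> Cod (op_cat X) f = B"
      using MorD by simp
  next
    fix f g h A B C D
    assume "f \<in> Mor (op_cat X) A B" "g \<in> Mor (op_cat X) B C" "h \<in> Mor (op_cat X) C D"
    then show "(h \<cdot>\<^bsub>op_cat X\<^esub> g) \<cdot>\<^bsub>op_cat X\<^esub> f = h \<cdot>\<^bsub>op_cat X\<^esub> (g \<cdot>\<^bsub>op_cat X\<^esub> f)"
      using comp_assoc[of h D C g B f A] by simp
  qed (simp_all add: Id_closed comp_closed Id_left Id_right Hom_comm_group comp_add_right comp_add_left)
qed


section \<open>Double complexes with exact rows and columns\<close>

text \<open>Both quotients are \<open>D\<close> modulo the common preimage of \<open>N\<close> and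
  \<open>M\<close>. Working with a span avoids choosing representatives for a connecting
  map.\<close>

lemma span_quotient_iso:
  assumes f: "f \<in> hom D G" and g: "g \<in> hom D H"
    and D: "group D" and N: "N \<lhd> G" and M: "M \<lhd> H"
    and fD: "f ` carrier D = carrier G" and gD: "g ` carrier D = carrier H"
    and iff: "\<And>w. w \<in> carrier D \<Longrightarrow> f w \<in> N \<longleftrightarrow> g w \<in> M"
  shows "G Mod N \<cong> H Mod M"
proof -
  have quot: "D Mod {w \<in> carrier D. k w \<in> L} \<cong> K Mod L"
      "K Mod L \<cong> D Mod {w \<in> carrier D. k w \<in> L}"
    if k: "k \<in> hom D K" and L: "L \<lhd> K" and kD: "k ` carrier D = carrier K"
    for K :: "('x, 'y) monoid_scheme" and k L
  proof -
    interpret L: normal L K by (rule L)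
    let ?q = "\<lambda>w. L #>\<^bsub>K\<^esub> k w"
    have hom: "?q \<in> hom D (K Mod L)"
      using hom_compose[OF k L.r_coset_hom_Mod] by (simp only: o_def)
    interpret q: group_hom D "K Mod L" ?q
      using hom D L.factorgroup_is_group by (simp add: group_hom_def group_hom_axioms_def)
    have "?q ` carrier D = (\<lambda>a. L #>\<^bsub>K\<^esub> a) ` carrier K"
      unfolding kD[symmetric] by (simp add: image_image)
    also have "\<dots> = carrier (K Mod L)"
      by (auto simp: FactGroup_def RCOSETS_def)
    finally have surj: "?q ` carrier D = carrier (K Mod L)" .
    have "L #>\<^bsub>K\<^esub> k w = L \<longleftrightarrow> k w \<in> L" if "w \<in> carrier D" for w
      using L.coset_join1[OF _ hom_in_carrier[OF k that] L.subgroup_axioms]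
        L.coset_join2[OF hom_in_carrier[OF k that] L.subgroup_axioms] by blast
    then have "kernel D (K Mod L) ?q = {w \<in> carrier D. k w \<in> L}"
      by (auto simp: kernel_def FactGroup_def)
    with q.FactGroup_iso[OF surj]
      group.iso_sym[OF normal.factorgroup_is_group[OF q.normal_kernel] q.FactGroup_iso[OF surj]]
    show "D Mod {w \<in> carrier D. k w \<in> L} \<cong> K Mod L"
      "K Mod L \<cong> D Mod {w \<in> carrier D. k w \<in> L}" by simp_all
  qed
  have "{w \<in> carrier D. f w \<in> N} = {w \<in> carrier D. g w \<in> M}"
    using iff by auto
  then show ?thesis
    using quot(2)[OF f N fD] quot(1)[OF g M gD] by (simp add: iso_trans)
qed

text \<open>Index 0 in either direction is the augmentation. Exactness is therefore assumed only for
  rows and columns of positive index, which leaves row 0 and column 0 as the edges to be compared.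
  The squares commute rather than anticommute, since no total complex is formed.\<close>

locale double_complex =
  fixes D :: "nat \<Rightarrow> nat \<Rightarrow> 'a monoid" and h v :: "nat \<Rightarrow> nat \<Rightarrow> 'a \<Rightarrow> 'a"
  assumes D_comm_group: "comm_group (D a b)"
    and h_hom: "h a b \<in> hom (D a b) (D (Suc a) b)"
    and v_hom: "v a b \<in> hom (D a b) (D a (Suc b))"
    and hh: "x \<in> carrier (D a b) \<Longrightarrow> h (Suc a) b (h a b x) = \<one>\<^bsub>D (Suc (Suc a)) b\<^esub>"
    and vv: "x \<in> carrier (D a b) \<Longrightarrow> v a (Suc b) (v a b x) = \<one>\<^bsub>D a (Suc (Suc b))\<^esub>"
    and hv: "x \<in> carrier (D a b) \<Longrightarrow> h a (Suc b) (v a b x) = v (Suc a) b (h a b x)"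
    and h_inj: "\<lbrakk>x \<in> carrier (D 0 (Suc b)); h 0 (Suc b) x = \<one>\<^bsub>D (Suc 0) (Suc b)\<^esub>\<rbrakk>
          \<Longrightarrow> x = \<one>\<^bsub>D 0 (Suc b)\<^esub>"
    and h_exact: "\<lbrakk>x \<in> carrier (D (Suc a) (Suc b)); h (Suc a) (Suc b) x = \<one>\<^bsub>D (Suc (Suc a)) (Suc b)\<^esub>\<rbrakk>
          \<Longrightarrow> \<exists>y\<in>carrier (D a (Suc b)). x = h a (Suc b) y"
    and v_inj: "\<lbrakk>x \<in> carrier (D (Suc a) 0); v (Suc a) 0 x = \<one>\<^bsub>D (Suc a) (Suc 0)\<^esub>\<rbrakk>
          \<Longrightarrow> x = \<one>\<^bsub>D (Suc a) 0\<^esub>"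
    and v_exact: "\<lbrakk>x \<in> carrier (D (Suc a) (Suc b)); v (Suc a) (Suc b) x = \<one>\<^bsub>D (Suc a) (Suc (Suc b))\<^esub>\<rbrakk>
          \<Longrightarrow> \<exists>y\<in>carrier (D (Suc a) b). x = v (Suc a) b y"
begin

text \<open>The hypotheses are symmetric in the two directions, so every statement about columns
  also serves for rows.\<close>

lemma transpose: "double_complex (\<lambda>a b. D b a) (\<lambda>a b. v b a) (\<lambda>a b. h b a)"
  by (rule double_complex.intro)
    (rule D_comm_group h_hom v_hom | erule hh vv hv[symmetric] | erule (1) h_inj v_inj h_exact v_exact)+

lemma D_group: "group (D a b)"
  using D_comm_group comm_group.axioms(2) by blast

lemma group_hom_h: "group_hom (D a b) (D (Suc a) b) (h a b)"
  by (simp add: group_hom_def group_hom_axioms_def D_group h_hom)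

lemma group_hom_v: "group_hom (D a b) (D a (Suc b)) (v a b)"
  by (simp add: group_hom_def group_hom_axioms_def D_group v_hom)

lemmas h_closed [simp, intro] = hom_in_carrier[OF h_hom]
lemmas v_closed [simp, intro] = hom_in_carrier[OF v_hom]
lemmas h_one [simp] = group_hom.hom_one[OF group_hom_h]
lemmas v_one [simp] = group_hom.hom_one[OF group_hom_v]
lemmas one_closed [simp, intro] = group.is_monoid[OF D_group, THEN monoid.one_closed]

text \<open>
  \<open>Qs a b\<close> interpolates between the two edge cohomologies in degree \<open>a + b\<close>: \<open>Qs 0 n\<close> is that of the
  column \<open>D 0 (Suc i)\<close> and \<open>Qs n 0\<close> that of the row \<open>D (Suc i) 0\<close>.  The corner \<open>D 0 0\<close> belongs to neither
  edge, so it contributes no boundaries in degree zero.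
\<close>

definition Zs :: "nat \<Rightarrow> nat \<Rightarrow> 'a set" where
  "Zs a b = {x \<in> carrier (D (Suc a) (Suc b)).
     h (Suc a) (Suc b) x = \<one>\<^bsub>D (Suc (Suc a)) (Suc b)\<^esub> \<and>
     v (Suc a) (Suc b) x = \<one>\<^bsub>D (Suc a) (Suc (Suc b))\<^esub>}"

text \<open>Away from the corner, \<open>Zs\<close> modulo \<open>Bs\<close> is the Bott-Chern
  cohomology of the double complex: the kernel of both differentials modulo the image of their
  composite.\<close>

definition Bs :: "nat \<Rightarrow> nat \<Rightarrow> 'a set" where
  "Bs a b = (if a = 0 \<and> b = 0 then {\<one>\<^bsub>D (Suc 0) (Suc 0)\<^esub>}
     else (\<lambda>w. h a (Suc b) (v a b w)) ` carrier (D a b))"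

definition Qs :: "nat \<Rightarrow> nat \<Rightarrow> 'a set monoid" where
  "Qs a b = (D (Suc a) (Suc b))\<lparr>carrier := Zs a b\<rparr> Mod Bs a b"

lemma subgroup_Zs: "subgroup (Zs a b) (D (Suc a) (Suc b))"
proof -
  have "Zs a b = kernel (D (Suc a) (Suc b)) (D (Suc (Suc a)) (Suc b)) (h (Suc a) (Suc b))
      \<inter> kernel (D (Suc a) (Suc b)) (D (Suc a) (Suc (Suc b))) (v (Suc a) (Suc b))"
    by (auto simp: Zs_def kernel_def)
  then show ?thesis
    using group.subgroups_Inter_pair[OF D_group group_hom.subgroup_kernel[OF group_hom_h]
        group_hom.subgroup_kernel[OF group_hom_v]] by simp
qed

lemma subgroup_Bs: "subgroup (Bs a b) (D (Suc a) (Suc b))"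
proof (cases "a = 0 \<and> b = 0")
  case True
  then show ?thesis
    using group.triv_subgroup[OF D_group] by (auto simp: Bs_def)
next
  case False
  have "group_hom (D a b) (D (Suc a) (Suc b)) (\<lambda>w. h a (Suc b) (v a b w))"
    using hom_compose[OF v_hom h_hom, of a b] D_group
    by (simp add: group_hom_def group_hom_axioms_def o_def)
  from group_hom.img_is_subgroup[OF this] show ?thesis
    unfolding Bs_def if_not_P[OF False] .
qed

lemma Bs_subset_Zs: "Bs a b \<subseteq> Zs a b"
proof
  fix x assume "x \<in> Bs a b"
  then show "x \<in> Zs a b"
    by (auto simp: Bs_def Zs_def hh hv vv split: if_splits)
qed

lemma normal_restrict:
  assumes "subgroup Z (D a b)" "subgroup B (D a b)" "B \<subseteq> Z"
  shows "B \<lhd> (D a b)\<lparr>carrier := Z\<rparr>"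
proof -
  have "comm_group ((D a b)\<lparr>carrier := Z\<rparr>)"
    using group.subgroup_imp_group[OF D_group assms(1)] comm_groupE(4)[OF D_comm_group]
      subgroup.mem_carrier[OF assms(1)]
    by (intro group.group_comm_groupI) auto
  then show ?thesis
    using comm_group.subgroup_imp_normal group.subgroup_incl[OF D_group assms(2,1,3)] by blast
qed

lemma normal_Bs: "Bs a b \<lhd> (D (Suc a) (Suc b))\<lparr>carrier := Zs a b\<rparr>"
  by (rule normal_restrict[OF subgroup_Zs subgroup_Bs Bs_subset_Zs])

text \<open>If v w = v (h y), then w - h y is v-closed, hence equal to some v z by column exactness;
  applying h removes h y and leaves h w = h (v z). Neither index pair is the corner, so both sets
  \<open>Bs\<close> are genuine images.\<close>

lemma staircase_mem:
  assumes w: "w \<in> carrier (D (Suc a) (Suc b))"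
    and vw: "v (Suc a) (Suc b) w \<in> Bs a (Suc b)"
  shows "h (Suc a) (Suc b) w \<in> Bs (Suc a) b"
proof -
  obtain y where y: "y \<in> carrier (D a (Suc b))"
    and "v (Suc a) (Suc b) w = h a (Suc (Suc b)) (v a (Suc b) y)"
    using vw by (auto simp: Bs_def)
  then have eq: "v (Suc a) (Suc b) w = v (Suc a) (Suc b) (h a (Suc b) y)"
    by (simp add: hv)
  interpret G: comm_group "D (Suc a) (Suc b)" by (rule D_comm_group)
  interpret V: group_hom "D (Suc a) (Suc b)" "D (Suc a) (Suc (Suc b))" "v (Suc a) (Suc b)"
    by (rule group_hom_v)
  interpret H: group_hom "D (Suc a) (Suc b)" "D (Suc (Suc a)) (Suc b)" "h (Suc a) (Suc b)"
    by (rule group_hom_h)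
  let ?c = "w \<otimes>\<^bsub>D (Suc a) (Suc b)\<^esub> inv\<^bsub>D (Suc a) (Suc b)\<^esub> h a (Suc b) y"
  have "v (Suc a) (Suc b) ?c = \<one>\<^bsub>D (Suc a) (Suc (Suc b))\<^esub>"
    using w y eq by simp
  then obtain z where z: "z \<in> carrier (D (Suc a) b)" "?c = v (Suc a) b z"
    using v_exact[of ?c a b] w y by auto
  have "h (Suc a) (Suc b) w = h (Suc a) (Suc b) ?c"
    using w y by (simp add: hh)
  then show ?thesis
    using z by (auto simp: Bs_def)
qed

end

lemma (in double_complex) Bs_transpose:
  "double_complex.Bs (\<lambda>a b. D b a) (\<lambda>a b. v b a) (\<lambda>a b. h b a) b a = Bs a b"
  unfolding Bs_def double_complex.Bs_def[OF transpose] by (auto simp: hv image_def)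

lemma (in double_complex) Zs_transpose:
  "double_complex.Zs (\<lambda>a b. D b a) (\<lambda>a b. v b a) (\<lambda>a b. h b a) b a = Zs a b"
  unfolding Zs_def double_complex.Zs_def[OF transpose] by auto

lemma (in double_complex) Qs_transpose:
  "double_complex.Qs (\<lambda>a b. D b a) (\<lambda>a b. v b a) (\<lambda>a b. h b a) b a = Qs a b"
  unfolding Qs_def double_complex.Qs_def[OF transpose] Bs_transpose Zs_transpose by simp

lemma (in double_complex) staircase_mem_iff:
  assumes "w \<in> carrier (D (Suc a) (Suc b))"
  shows "v (Suc a) (Suc b) w \<in> Bs a (Suc b) \<longleftrightarrow> h (Suc a) (Suc b) w \<in> Bs (Suc a) b"
  using staircase_mem[OF assms] double_complex.staircase_mem[OF transpose assms]
  unfolding Bs_transpose by blast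

text \<open>The span has as its top the kernel of the diagonal composite h v on one square. Column
  exactness makes v map it onto \<open>Zs a (Suc b)\<close>, row exactness makes h map it onto
  \<open>Zs (Suc a) b\<close>, and \<open>staircase_mem_iff\<close> matches the boundaries.\<close>

lemma (in double_complex) staircase: "Qs a (Suc b) \<cong> Qs (Suc a) b"
proof -
  let ?W = "{w \<in> carrier (D (Suc a) (Suc b)).
    h (Suc a) (Suc (Suc b)) (v (Suc a) (Suc b) w) = \<one>\<^bsub>D (Suc (Suc a)) (Suc (Suc b))\<^esub>}"
  have hom: "(\<lambda>w. h (Suc a) (Suc (Suc b)) (v (Suc a) (Suc b) w))
      \<in> hom (D (Suc a) (Suc b)) (D (Suc (Suc a)) (Suc (Suc b)))"
    using hom_compose[OF v_hom h_hom] by (simp add: o_def)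
  have W: "subgroup ?W (D (Suc a) (Suc b))"
    using group_hom.subgroup_kernel[of "D (Suc a) (Suc b)" "D (Suc (Suc a)) (Suc (Suc b))"
        "\<lambda>w. h (Suc a) (Suc (Suc b)) (v (Suc a) (Suc b) w)"]
      hom D_group
    by (simp add: group_hom_def group_hom_axioms_def kernel_def)
  have v_img: "v (Suc a) (Suc b) ` ?W = Zs a (Suc b)"
    using v_exact[of _ a "Suc b"] by (auto simp: Zs_def vv image_iff)
  have h_img: "h (Suc a) (Suc b) ` ?W = Zs (Suc a) b"
  proof
    show "h (Suc a) (Suc b) ` ?W \<subseteq> Zs (Suc a) b"
      by (auto simp: Zs_def hh hv)
    show "Zs (Suc a) b \<subseteq> h (Suc a) (Suc b) ` ?W"
    proof
      fix z assume z: "z \<in> Zs (Suc a) b"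
      then obtain w where "w \<in> carrier (D (Suc a) (Suc b))" "z = h (Suc a) (Suc b) w"
        using h_exact[of z "Suc a" b] by (auto simp: Zs_def)
      with z show "z \<in> h (Suc a) (Suc b) ` ?W"
        by (auto simp: Zs_def hv)
    qed
  qed
  show ?thesis
    unfolding Qs_def
  proof (rule span_quotient_iso[OF _ _ _ normal_Bs normal_Bs])
    show "v (Suc a) (Suc b) \<in> hom (D (Suc a) (Suc b)\<lparr>carrier := ?W\<rparr>)
        (D (Suc a) (Suc (Suc b))\<lparr>carrier := Zs a (Suc b)\<rparr>)"
      using v_hom[of "Suc a" "Suc b"] v_img by (auto simp: hom_def)
    show "h (Suc a) (Suc b) \<in> hom (D (Suc a) (Suc b)\<lparr>carrier := ?W\<rparr>)
        (D (Suc (Suc a)) (Suc b)\<lparr>carrier := Zs (Suc a) b\<rparr>)"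
      using h_hom[of "Suc a" "Suc b"] h_img by (auto simp: hom_def)
    show "group (D (Suc a) (Suc b)\<lparr>carrier := ?W\<rparr>)"
      by (rule group.subgroup_imp_group[OF D_group W])
  qed (use v_img h_img staircase_mem_iff in auto)
qed

lemma (in double_complex) Qs_0: "Qs 0 n \<cong> Qs n 0"
proof -
  \<comment> \<open>Each increase of \<open>k\<close> costs one unit of the second index, so
    \<open>m\<close> has to vary in the induction.\<close>
  have "Qs 0 (m + k) \<cong> Qs k m" for m k
  proof (induction k arbitrary: m)
    case (Suc k)
    then show ?case using iso_trans[OF Suc[of "Suc m"] staircase] by simp
  qed simp
  from this[of 0 n] show ?thesis by simp
qed

text \<open>The augmentation h embeds column 0 into column 1 and carries cocycles onto
  \<open>Zs 0 n\<close> and coboundaries onto \<open>Bs 0 n\<close>; one leg of the span is the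
  identity. In degree zero both boundary groups are trivial, which is the purpose of the corner case
  in \<open>Bs\<close>.\<close>

lemma (in double_complex) column_end:
  "Qs 0 n \<cong> cohomology (\<lambda>i. D 0 (Suc i)) (\<lambda>i. v 0 (Suc i)) n"
proof -
  let ?Z = "kernel (D 0 (Suc n)) (D 0 (Suc (Suc n))) (v 0 (Suc n))"
  let ?B = "case n of 0 \<Rightarrow> {\<one>\<^bsub>D 0 (Suc 0)\<^esub>} | Suc m \<Rightarrow> v 0 (Suc m) ` carrier (D 0 (Suc m))"
  interpret H: group_hom "D 0 (Suc n)" "D (Suc 0) (Suc n)" "h 0 (Suc n)"
    by (rule group_hom_h)
  have inj: "inj_on (h 0 (Suc n)) (carrier (D 0 (Suc n)))"
    using h_inj by (simp add: H.inj_on_one_iff)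
  \<comment> \<open>Injectivity of h in the next row reflects cocycles back to column 0.\<close>
  have v_mono: "v 0 (Suc n) x = \<one>\<^bsub>D 0 (Suc (Suc n))\<^esub>"
    if x: "x \<in> carrier (D 0 (Suc n))"
      and z: "v (Suc 0) (Suc n) (h 0 (Suc n) x) = \<one>\<^bsub>D (Suc 0) (Suc (Suc n))\<^esub>" for x
    using h_inj[of "v 0 (Suc n) x"] x z by (simp add: hv)
  have img: "h 0 (Suc n) ` ?Z = Zs 0 n"
  proof
    show "h 0 (Suc n) ` ?Z \<subseteq> Zs 0 n"
      by (auto simp: Zs_def kernel_def hh hv[symmetric])
    show "Zs 0 n \<subseteq> h 0 (Suc n) ` ?Z"
    proof
      fix z assume z: "z \<in> Zs 0 n"
      then obtain x where "x \<in> carrier (D 0 (Suc n))" "z = h 0 (Suc n) x"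
        using h_exact[of z 0 n] by (auto simp: Zs_def)
      with z v_mono show "z \<in> h 0 (Suc n) ` ?Z" by (auto simp: Zs_def kernel_def)
    qed
  qed
  have B: "subgroup ?B (D 0 (Suc n))"
    using group.triv_subgroup[OF D_group] group_hom.img_is_subgroup[OF group_hom_v]
    by (auto split: nat.split)
  have Z: "subgroup ?Z (D 0 (Suc n))"
    by (rule group_hom.subgroup_kernel[OF group_hom_v])
  have BZ: "?B \<subseteq> ?Z"
    by (auto simp: kernel_def vv split: nat.split)
  have hB: "h 0 (Suc n) ` ?B = Bs 0 n"
    by (auto simp: Bs_def image_image split: nat.split)
  have "h 0 (Suc n) w \<in> Bs 0 n \<longleftrightarrow> w \<in> ?B" if "w \<in> ?Z" for w
    using that BZ inj_on_image_mem_iff[OF inj, of w ?B] subgroup.subset[OF Z]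
    unfolding hB[symmetric] by blast
  then show ?thesis
    unfolding Qs_def cohomology_def
    by (intro span_quotient_iso[where D = "D 0 (Suc n)\<lparr>carrier := ?Z\<rparr>" and f = "h 0 (Suc n)" and g = "\<lambda>x. x"]
        normal_restrict[OF Z B BZ] normal_Bs group.subgroup_imp_group[OF D_group Z])
      (use img h_hom[of 0 "Suc n"] in \<open>auto simp: hom_def kernel_def\<close>)
qed

theorem (in double_complex) balance:
  "cohomology (\<lambda>i. D (Suc i) 0) (\<lambda>i. h (Suc i) 0) n \<cong>
   cohomology (\<lambda>i. D 0 (Suc i)) (\<lambda>i. v 0 (Suc i)) n"
proof -
  have Q: "group (Qs a b)" for a b
    unfolding Qs_def by (rule normal.factorgroup_is_group[OF normal_Bs])
  \<comment> \<open>The bottom row is the zeroth column of the transposed complex.\<close>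
  have R: "Qs n 0 \<cong> cohomology (\<lambda>i. D (Suc i) 0) (\<lambda>i. h (Suc i) 0) n"
    using double_complex.column_end[OF transpose, of n] unfolding Qs_transpose .
  have "cohomology (\<lambda>i. D (Suc i) 0) (\<lambda>i. h (Suc i) 0) n \<cong> Qs n 0"
    by (rule group.iso_sym[OF Q R])
  also have "Qs n 0 \<cong> Qs 0 n"
    by (rule group.iso_sym[OF Q Qs_0])
  also note column_end
  finally show ?thesis .
qed


section \<open>Triangles in extriangulated categories\<close>

context additive_category
begin

lemma Mor_objD: "f \<in> Mor X A B \<Longrightarrow> A \<in> Obj X" "f \<in> Mor X A B \<Longrightarrow> B \<in> Obj X"
  using MorD by blast+

lemma Hom_group: "\<lbrakk>A \<in> Obj X; B \<in> Obj X\<rbrakk> \<Longrightarrow> group (Hom X A B)"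
  using Hom_comm_group comm_group.axioms(2) by blast

lemma zero_closed [simp, intro]: "\<lbrakk>A \<in> Obj X; B \<in> Obj X\<rbrakk> \<Longrightarrow> \<one>\<^bsub>Hom X A B\<^esub> \<in> Mor X A B"
  using Hom_group group.is_monoid monoid.one_closed by blast

lemma comp_hom_left:
  "\<lbrakk>A \<in> Obj X; g \<in> Mor X B C\<rbrakk> \<Longrightarrow> (\<lambda>f. g \<cdot> f) \<in> hom (Hom X A B) (Hom X A C)"
  using comp_closed comp_add_right by (auto simp: hom_def)

lemma comp_hom_right:
  "\<lbrakk>f \<in> Mor X A B; C \<in> Obj X\<rbrakk> \<Longrightarrow> (\<lambda>g. g \<cdot> f) \<in> hom (Hom X B C) (Hom X A C)"
  using comp_closed comp_add_left by (auto simp: hom_def)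

lemma comp_group_hom_left:
  "\<lbrakk>A \<in> Obj X; g \<in> Mor X B C\<rbrakk> \<Longrightarrow> group_hom (Hom X A B) (Hom X A C) (\<lambda>f. g \<cdot> f)"
  using comp_hom_left Hom_group Mor_objD by (simp add: group_hom_def group_hom_axioms_def)

lemma comp_group_hom_right:
  "\<lbrakk>f \<in> Mor X A B; C \<in> Obj X\<rbrakk> \<Longrightarrow> group_hom (Hom X B C) (Hom X A C) (\<lambda>g. g \<cdot> f)"
  using comp_hom_right Hom_group Mor_objD by (simp add: group_hom_def group_hom_axioms_def)

lemma comp_zero_right: "\<lbrakk>A \<in> Obj X; g \<in> Mor X B C\<rbrakk> \<Longrightarrow> g \<cdot> \<one>\<^bsub>Hom X A B\<^esub> = \<one>\<^bsub>Hom X A C\<^esub>"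
  using group_hom.hom_one[OF comp_group_hom_left] .

lemma comp_zero_left: "\<lbrakk>f \<in> Mor X A B; C \<in> Obj X\<rbrakk> \<Longrightarrow> \<one>\<^bsub>Hom X B C\<^esub> \<cdot> f = \<one>\<^bsub>Hom X A C\<^esub>"
  using group_hom.hom_one[OF comp_group_hom_right] .

lemma Mor_zero_right: "\<lbrakk>zero_object X Z; f \<in> Mor X A Z\<rbrakk> \<Longrightarrow> f = \<one>\<^bsub>Hom X A Z\<^esub>"
  using Mor_objD by (fastforce simp: zero_object_def)

lemma Mor_zero_left: "\<lbrakk>zero_object X Z; f \<in> Mor X Z A\<rbrakk> \<Longrightarrow> f = \<one>\<^bsub>Hom X Z A\<^esub>"
  using Mor_objD by (fastforce simp: zero_object_def)

text \<open>Through \<open>ET2_zero\<close> these biproducts give the degenerate triangles Z -> P =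
  P and P = P -> Z, the test triangles for (ET3) and its dual.\<close>

lemma biproduct_zero:
  assumes Z: "zero_object X Z" and P: "P \<in> Obj X"
  shows "is_biproduct X Z P \<lparr>sum_obj = P, inj1 = \<one>\<^bsub>Hom X Z P\<^esub>, inj2 = Id X P,
    prj1 = \<one>\<^bsub>Hom X P Z\<^esub>, prj2 = Id X P\<rparr>"
    and "is_biproduct X P Z \<lparr>sum_obj = P, inj1 = Id X P, inj2 = \<one>\<^bsub>Hom X Z P\<^esub>,
    prj1 = Id X P, prj2 = \<one>\<^bsub>Hom X P Z\<^esub>\<rparr>"
proof -
  have ZO: "Z \<in> Obj X" using Z by (simp add: zero_object_def)
  interpret group "Hom X P P" by (rule Hom_group[OF P P])
  have "Id X Z = \<one>\<^bsub>Hom X Z Z\<^esub>" by (rule Mor_zero_right[OF Z Id_closed[OF ZO]])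
  moreover have s: "(\<one>\<^bsub>Hom X Z P\<^esub> \<cdot> \<one>\<^bsub>Hom X P Z\<^esub>) \<otimes>\<^bsub>Hom X P P\<^esub> Id X P = Id X P"
    "Id X P \<otimes>\<^bsub>Hom X P P\<^esub> (\<one>\<^bsub>Hom X Z P\<^esub> \<cdot> \<one>\<^bsub>Hom X P Z\<^esub>) = Id X P"
    using comp_zero_right[OF P zero_closed[OF ZO P]] Id_closed[OF P] by simp_all
  ultimately show "is_biproduct X Z P \<lparr>sum_obj = P, inj1 = \<one>\<^bsub>Hom X Z P\<^esub>, inj2 = Id X P,
      prj1 = \<one>\<^bsub>Hom X P Z\<^esub>, prj2 = Id X P\<rparr>"
    "is_biproduct X P Z \<lparr>sum_obj = P, inj1 = Id X P, inj2 = \<one>\<^bsub>Hom X Z P\<^esub>,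
      prj1 = Id X P, prj2 = \<one>\<^bsub>Hom X P Z\<^esub>\<rparr>"
    using ZO P by (auto simp: s is_biproduct_def Id_closed comp_zero_right[of _ _ Z]
        comp_zero_left[of _ _ Z] comp_zero_right[of _ _ P] comp_zero_left[of _ _ P]
        Id_left[OF Id_closed] Id_left[OF zero_closed] Id_right[OF zero_closed])
qed

end

context extriangulated_category
begin

lemma etriangleD:
  assumes "etriangle X A x B y C \<delta>"
  shows "x \<in> Mor X A B" "y \<in> Mor X B C" "\<delta> \<in> carrier (Ext X C A)"
    "A \<in> Obj X" "B \<in> Obj X" "C \<in> Obj X"
  using assms Mor_objD by (auto simp: etriangle_def)

lemma Ext_group: "\<lbrakk>C \<in> Obj X; A \<in> Obj X\<rbrakk> \<Longrightarrow> group (Ext X C A)"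
  using Ext_comm_group comm_group.axioms(2) by blast

lemma Ext_one_closed: "\<lbrakk>C \<in> Obj X; A \<in> Obj X\<rbrakk> \<Longrightarrow> \<one>\<^bsub>Ext X C A\<^esub> \<in> carrier (Ext X C A)"
  using Ext_group group.is_monoid monoid.one_closed by blast

lemma emap_one:
  assumes "c \<in> Mor X C' C" "a \<in> Mor X A A'"
  shows "emap X c a \<one>\<^bsub>Ext X C A\<^esub> = \<one>\<^bsub>Ext X C' A'\<^esub>"
  using hom_one[OF emap_hom[OF assms]] assms Mor_objD Ext_group by blast

lemma push_one: "\<lbrakk>C \<in> Obj X; a \<in> Mor X A A'\<rbrakk> \<Longrightarrow> push X C a \<one>\<^bsub>Ext X C A\<^esub> = \<one>\<^bsub>Ext X C A'\<^esub>"
  by (simp add: push_def emap_one Id_closed)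

lemma pull_one: "\<lbrakk>A \<in> Obj X; c \<in> Mor X C' C\<rbrakk> \<Longrightarrow> pull X A c \<one>\<^bsub>Ext X C A\<^esub> = \<one>\<^bsub>Ext X C' A\<^esub>"
  by (simp add: pull_def emap_one Id_closed)

lemma etriangle_biproduct:
  assumes "is_biproduct X A C S"
  shows "etriangle X A (inj1 S) (sum_obj S) (prj2 S) C \<one>\<^bsub>Ext X C A\<^esub>"
  using assms ET2_zero[OF assms] Ext_one_closed by (auto simp: etriangle_def is_biproduct_def)

lemma etriangle_zero_left:
  "\<lbrakk>zero_object X Z; P \<in> Obj X\<rbrakk> \<Longrightarrow> etriangle X Z \<one>\<^bsub>Hom X Z P\<^esub> P (Id X P) P \<one>\<^bsub>Ext X P Z\<^esub>"
  using etriangle_biproduct[OF biproduct_zero(1)] by simp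

lemma etriangle_zero_right:
  "\<lbrakk>zero_object X Z; P \<in> Obj X\<rbrakk> \<Longrightarrow> etriangle X P (Id X P) P \<one>\<^bsub>Hom X P Z\<^esub> Z \<one>\<^bsub>Ext X Z P\<^esub>"
  using etriangle_biproduct[OF biproduct_zero(2)] by simp

text \<open>(ET3), applied to the pair (\<open>Id X A\<close>, \<open>x\<close>) from A = A -> Z
  into the given triangle, factors \<open>y \<cdot> x\<close> through a zero object.\<close>

lemma etriangle_comp_zero:
  assumes T: "etriangle X A x B y C \<delta>"
  shows "y \<cdot> x = \<one>\<^bsub>Hom X A C\<^esub>"
proof -
  note D = etriangleD[OF T]
  obtain Z where Z: "zero_object X Z" using ex_zero_object by blast
  then have ZO: "Z \<in> Obj X" by (simp add: zero_object_def)
  obtain c where "c \<in> Mor X Z C" "c \<cdot> \<one>\<^bsub>Hom X A Z\<^esub> = y \<cdot> x"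
    using ET3[OF etriangle_zero_right[OF Z D(4)] T Id_closed[OF D(4)] D(1) refl] by blast
  then show ?thesis using comp_zero_right[OF D(4)] by metis
qed

text \<open>Dual (ET3) is applied to \<open>u\<close> and the zero map out of \<open>Z\<close>,
  starting from the triangle W = W -> Z; the map it supplies on first terms is the factorization. It
  need not be unique.\<close>

lemma etriangle_weak_kernel:
  assumes T: "etriangle X A x B y C \<delta>" and u: "u \<in> Mor X W B" "y \<cdot> u = \<one>\<^bsub>Hom X W C\<^esub>"
  shows "\<exists>v\<in>Mor X W A. u = x \<cdot> v"
proof -
  note D = etriangleD[OF T] Mor_objD[OF u(1)]
  obtain Z where Z: "zero_object X Z" using ex_zero_object by blast
  then have ZO: "Z \<in> Obj X" by (simp add: zero_object_def)
  have "\<one>\<^bsub>Hom X Z C\<^esub> \<cdot> \<one>\<^bsub>Hom X W Z\<^esub> = y \<cdot> u"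
    using u(2) comp_zero_right[OF D(7) zero_closed[OF ZO D(6)]] by simp
  then obtain a where "a \<in> Mor X W A" "u \<cdot> Id X W = x \<cdot> a"
    using ET3_op[OF etriangle_zero_right[OF Z D(7)] T u(1) zero_closed[OF ZO D(6)]] by blast
  then show ?thesis using Id_right[OF u(1)] by auto
qed

lemma etriangle_weak_cokernel:
  assumes T: "etriangle X A x B y C \<delta>" and u: "u \<in> Mor X B W" "u \<cdot> x = \<one>\<^bsub>Hom X A W\<^esub>"
  shows "\<exists>v\<in>Mor X C W. u = v \<cdot> y"
proof -
  note D = etriangleD[OF T] Mor_objD[OF u(1)]
  obtain Z where Z: "zero_object X Z" using ex_zero_object by blast
  then have ZO: "Z \<in> Obj X" by (simp add: zero_object_def)
  have "u \<cdot> x = \<one>\<^bsub>Hom X Z W\<^esub> \<cdot> \<one>\<^bsub>Hom X A Z\<^esub>"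
    using u(2) comp_zero_right[OF D(4) zero_closed[OF ZO D(8)]] by simp
  then obtain c where "c \<in> Mor X C W" "c \<cdot> y = Id X W \<cdot> u"
    using ET3[OF T etriangle_zero_left[OF Z D(8)] zero_closed[OF D(4) ZO] u(1)] by blast
  then show ?thesis using Id_left[OF u(1)] by auto
qed

text \<open>The pulled back class is the obstruction to lifting. A lift gives a morphism from the
  triangle Z -> W = W, whose class is zero. Conversely, if the class vanishes, the split triangle on
  A and W maps to the given one over \<open>c\<close>, and restriction to the summand
  \<open>W\<close> is a lift.\<close>

lemma lifts_iff_pull_one:
  assumes T: "etriangle X A x B y C \<delta>" and c: "c \<in> Mor X W C"
  shows "(\<exists>b\<in>Mor X W B. y \<cdot> b = c) \<longleftrightarrow> pull X A c \<delta> = \<one>\<^bsub>Ext X W A\<^esub>"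
proof
  note D = etriangleD[OF T] Mor_objD[OF c]
  obtain Z where Z: "zero_object X Z" using ex_zero_object by blast
  assume "\<exists>b\<in>Mor X W B. y \<cdot> b = c"
  then obtain b where b: "b \<in> Mor X W B" "y \<cdot> b = c" by blast
  then have "c \<cdot> Id X W = y \<cdot> b" using Id_right[OF c] by simp
  then obtain a where a: "a \<in> Mor X Z A" and "ext_mor X Z W \<one>\<^bsub>Ext X W Z\<^esub> A C \<delta> a c"
    using ET3_op[OF etriangle_zero_left[OF Z D(7)] T b(1) c] by blast
  then show "pull X A c \<delta> = \<one>\<^bsub>Ext X W A\<^esub>"
    using push_one[OF D(7) a] by (simp add: ext_mor_def)
next
  note D = etriangleD[OF T] Mor_objD[OF c]
  obtain S where S: "is_biproduct X A W S" using ex_biproduct[OF D(4,7)] by blast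
  then have S': "inj2 S \<in> Mor X W (sum_obj S)" "prj2 S \<in> Mor X (sum_obj S) W"
    "prj2 S \<cdot> inj2 S = Id X W"
    by (auto simp: is_biproduct_def)
  assume "pull X A c \<delta> = \<one>\<^bsub>Ext X W A\<^esub>"
  then have "ext_mor X A W \<one>\<^bsub>Ext X W A\<^esub> A C \<delta> (Id X A) c"
    using D c by (simp add: ext_mor_def Id_closed push_one Ext_one_closed)
  then obtain b where b: "b \<in> Mor X (sum_obj S) B" "y \<cdot> b = c \<cdot> prj2 S"
    using ET2_mor[OF etriangle_biproduct[OF S] T] by blast
  have "y \<cdot> (b \<cdot> inj2 S) = c"
    using b S' c D comp_assoc[OF S'(1) b(1) D(2)] comp_assoc[OF S'(1,2) c] Id_right[OF c] by simp
  then show "\<exists>b\<in>Mor X W B. y \<cdot> b = c"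
    using comp_closed[OF S'(1) b(1)] by blast
qed

text \<open>Dually, the pushed out class obstructs extension; the split triangle is now the target,
  and projecting to its summand \<open>W\<close> gives the extension.\<close>

lemma extends_iff_push_one:
  assumes T: "etriangle X A x B y C \<delta>" and a: "a \<in> Mor X A W"
  shows "(\<exists>b\<in>Mor X B W. b \<cdot> x = a) \<longleftrightarrow> push X C a \<delta> = \<one>\<^bsub>Ext X C W\<^esub>"
proof
  note D = etriangleD[OF T] Mor_objD[OF a]
  obtain Z where Z: "zero_object X Z" using ex_zero_object by blast
  assume "\<exists>b\<in>Mor X B W. b \<cdot> x = a"
  then obtain b where b: "b \<in> Mor X B W" "b \<cdot> x = a" by blast
  then have "b \<cdot> x = Id X W \<cdot> a" using Id_left[OF a] by simp
  then obtain c where c: "c \<in> Mor X C Z" and "ext_mor X A C \<delta> W Z \<one>\<^bsub>Ext X Z W\<^esub> a c"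
    using ET3[OF T etriangle_zero_right[OF Z D(8)] a b(1)] by blast
  then show "push X C a \<delta> = \<one>\<^bsub>Ext X C W\<^esub>"
    using pull_one[OF D(8) c] by (simp add: ext_mor_def)
next
  note D = etriangleD[OF T] Mor_objD[OF a]
  obtain S where S: "is_biproduct X W C S" using ex_biproduct[OF D(8,6)] by blast
  then have S': "inj1 S \<in> Mor X W (sum_obj S)" "prj1 S \<in> Mor X (sum_obj S) W"
    "prj1 S \<cdot> inj1 S = Id X W"
    by (auto simp: is_biproduct_def)
  assume "push X C a \<delta> = \<one>\<^bsub>Ext X C W\<^esub>"
  then have "ext_mor X A C \<delta> W C \<one>\<^bsub>Ext X C W\<^esub> a (Id X C)"
    using D a pull_one[OF D(8) Id_closed[OF D(6)]]
    by (simp add: ext_mor_def Id_closed Ext_one_closed)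
  then obtain b where b: "b \<in> Mor X B (sum_obj S)" "b \<cdot> x = inj1 S \<cdot> a"
    using ET2_mor[OF T etriangle_biproduct[OF S]] by blast
  have "(prj1 S \<cdot> b) \<cdot> x = a"
    using b S' a D comp_assoc[OF D(1) b(1) S'(2)] comp_assoc[OF a S'(1,2)] Id_left[OF a] by simp
  then show "\<exists>b\<in>Mor X B W. b \<cdot> x = a"
    using comp_closed[OF b(1) S'(2)] by blast
qed

text \<open>The obstructions to extending \<open>a\<close> and to lifting \<open>c\<close> are the
  two sides of the equation that defines a morphism of extensions.\<close>

lemma ext_mor_extends_iff_lifts:
  assumes T: "etriangle X A x B y C \<delta>" and T': "etriangle X A' x' B' y' C' \<delta>'"
    and ac: "ext_mor X A C \<delta> A' C' \<delta>' a c"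
  shows "(\<exists>a'\<in>Mor X B A'. a' \<cdot> x = a) \<longleftrightarrow> (\<exists>c'\<in>Mor X C B'. y' \<cdot> c' = c)"
  using extends_iff_push_one[OF T, of a A'] lifts_iff_pull_one[OF T', of c C] ac
  by (auto simp: ext_mor_def)

end

text \<open>
  Unlike the axioms of a proper class, of which saturation is not accompanied by its dual, these
  weaker assumptions pass to the opposite category by mere symmetry.
\<close>

locale half_exact_class = additive_category X
  for X :: "('o, 'm, 'e) extri" (structure) and \<xi> :: "('m \<times> 'm \<times> 'e) set" +
  assumes tri_comp_zero: "tri_in X \<xi> A x B y C \<delta> \<Longrightarrow> y \<cdot> x = \<one>\<^bsub>Hom X A C\<^esub>"
    and weak_kernel: "\<lbrakk>tri_in X \<xi> A x B y C \<delta>; u \<in> Mor X W B; y \<cdot> u = \<one>\<^bsub>Hom X W C\<^esub>\<rbrakk>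
          \<Longrightarrow> \<exists>v\<in>Mor X W A. u = x \<cdot> v"
    and weak_cokernel: "\<lbrakk>tri_in X \<xi> A x B y C \<delta>; u \<in> Mor X B W; u \<cdot> x = \<one>\<^bsub>Hom X A W\<^esub>\<rbrakk>
          \<Longrightarrow> \<exists>v\<in>Mor X C W. u = v \<cdot> y"
    and fill_left: "\<lbrakk>tri_in X \<xi> A x B y C \<delta>; tri_in X \<xi> A' x' B' y' C' \<delta>';
             b \<in> Mor X B B'; c \<in> Mor X C C'; c \<cdot> y = y' \<cdot> b\<rbrakk>
          \<Longrightarrow> \<exists>a\<in>Mor X A A'. b \<cdot> x = x' \<cdot> a \<and>
             ((\<exists>a'\<in>Mor X B A'. a' \<cdot> x = a) \<longleftrightarrow> (\<exists>c'\<in>Mor X C B'. y' \<cdot> c' = c))"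
    and fill_right: "\<lbrakk>tri_in X \<xi> A x B y C \<delta>; tri_in X \<xi> A' x' B' y' C' \<delta>';
             a \<in> Mor X A A'; b \<in> Mor X B B'; b \<cdot> x = x' \<cdot> a\<rbrakk>
          \<Longrightarrow> \<exists>c\<in>Mor X C C'. c \<cdot> y = y' \<cdot> b \<and>
             ((\<exists>a'\<in>Mor X B A'. a' \<cdot> x = a) \<longleftrightarrow> (\<exists>c'\<in>Mor X C B'. y' \<cdot> c' = c))"
    and tri_zero_left: "\<lbrakk>zero_object X Z; P \<in> Obj X\<rbrakk>
          \<Longrightarrow> \<exists>\<delta>. tri_in X \<xi> Z \<one>\<^bsub>Hom X Z P\<^esub> P (Id X P) P \<delta>"
    and tri_zero_right: "\<lbrakk>zero_object X Z; P \<in> Obj X\<rbrakk>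
          \<Longrightarrow> \<exists>\<delta>. tri_in X \<xi> P (Id X P) P \<one>\<^bsub>Hom X P Z\<^esub> Z \<delta>"

text \<open>Extension groups disappear from the argument here: \<open>fill_left\<close> and
  \<open>fill_right\<close> keep only the coincidence of the two obstructions.\<close>

sublocale proper_class \<subseteq> half_exact_class
proof
  show "y \<cdot> x = \<one>\<^bsub>Hom X A C\<^esub>" if "tri_in X \<xi> A x B y C \<delta>" for A x B y C \<delta>
    using etriangle_comp_zero that by (auto simp: tri_in_def)
next
  show "\<exists>v\<in>Mor X W A. u = x \<cdot> v"
    if "tri_in X \<xi> A x B y C \<delta>" "u \<in> Mor X W B" "y \<cdot> u = \<one>\<^bsub>Hom X W C\<^esub>" for A x B y C \<delta> u W
    using etriangle_weak_kernel that by (auto simp: tri_in_def)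
next
  show "\<exists>v\<in>Mor X C W. u = v \<cdot> y"
    if "tri_in X \<xi> A x B y C \<delta>" "u \<in> Mor X B W" "u \<cdot> x = \<one>\<^bsub>Hom X A W\<^esub>" for A x B y C \<delta> u W
    using etriangle_weak_cokernel that by (auto simp: tri_in_def)
next
  fix A x B y C \<delta> A' x' B' y' C' \<delta>' b c
  assume "tri_in X \<xi> A x B y C \<delta>" "tri_in X \<xi> A' x' B' y' C' \<delta>'"
    and bc: "b \<in> Mor X B B'" "c \<in> Mor X C C'" "c \<cdot> y = y' \<cdot> b"
  then have T: "etriangle X A x B y C \<delta>" "etriangle X A' x' B' y' C' \<delta>'"
    by (simp_all add: tri_in_def)
  from ET3_op[OF T bc] ext_mor_extends_iff_lifts[OF T]
  show "\<exists>a\<in>Mor X A A'. b \<cdot> x = x' \<cdot> a \<and>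
      ((\<exists>a'\<in>Mor X B A'. a' \<cdot> x = a) \<longleftrightarrow> (\<exists>c'\<in>Mor X C B'. y' \<cdot> c' = c))" by blast
next
  fix A x B y C \<delta> A' x' B' y' C' \<delta>' a b
  assume "tri_in X \<xi> A x B y C \<delta>" "tri_in X \<xi> A' x' B' y' C' \<delta>'"
    and ab: "a \<in> Mor X A A'" "b \<in> Mor X B B'" "b \<cdot> x = x' \<cdot> a"
  then have T: "etriangle X A x B y C \<delta>" "etriangle X A' x' B' y' C' \<delta>'"
    by (simp_all add: tri_in_def)
  from ET3[OF T ab] ext_mor_extends_iff_lifts[OF T]
  show "\<exists>c\<in>Mor X C C'. c \<cdot> y = y' \<cdot> b \<and>
      ((\<exists>a'\<in>Mor X B A'. a' \<cdot> x = a) \<longleftrightarrow> (\<exists>c'\<in>Mor X C B'. y' \<cdot> c' = c))" by blast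
next
  fix Z P assume "zero_object X Z" "P \<in> Obj X"
  then show "\<exists>\<delta>. tri_in X \<xi> Z \<one>\<^bsub>Hom X Z P\<^esub> P (Id X P) P \<delta>"
    "\<exists>\<delta>. tri_in X \<xi> P (Id X P) P \<one>\<^bsub>Hom X P Z\<^esub> Z \<delta>"
    using split_in etriangle_zero_left etriangle_zero_right by blast+
qed

lemma half_exact_class_op_cat:
  assumes "half_exact_class X \<xi>"
  shows "half_exact_class (op_cat X) (op_class \<xi>)"
proof -
  interpret half_exact_class X \<xi> by (rule assms)
  show ?thesis
  proof (rule half_exact_class.intro[OF additive_category_op_cat], unfold_locales,
      unfold tri_in_op_cat op_cat_simps zero_object_op_cat)
    fix A x B y C \<delta> A' x' B' y' C' \<delta>' b c
    assume "tri_in X \<xi> C y B x A \<delta>" "tri_in X \<xi> C' y' B' x' A' \<delta>'"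
      and "b \<in> Mor X B' B" "c \<in> Mor X C' C" "y \<cdot>\<^bsub>X\<^esub> c = b \<cdot>\<^bsub>X\<^esub> y'"
    \<comment> \<open>Reversing arrows exchanges the source and target triangles, and with them
      \<open>fill_left\<close> and \<open>fill_right\<close>.\<close>
    from fill_right[OF this(2,1,4,3) this(5)[symmetric]]
    obtain a where "a \<in> Mor X A' A" "x \<cdot>\<^bsub>X\<^esub> b = a \<cdot>\<^bsub>X\<^esub> x'"
      and iff: "(\<exists>c'\<in>Mor X B' C. c' \<cdot>\<^bsub>X\<^esub> y' = c) \<longleftrightarrow> (\<exists>a'\<in>Mor X A' B. x \<cdot>\<^bsub>X\<^esub> a' = a)"
      by (metis (no_types, lifting))
    then show "\<exists>a\<in>Mor X A' A. x \<cdot>\<^bsub>X\<^esub> b = a \<cdot>\<^bsub>X\<^esub> x' \<and>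
       ((\<exists>a'\<in>Mor X A' B. x \<cdot>\<^bsub>X\<^esub> a' = a) \<longleftrightarrow> (\<exists>c'\<in>Mor X B' C. c' \<cdot>\<^bsub>X\<^esub> y' = c))"
      by - (rule bexI[of _ a], rule conjI, assumption, simp only: iff, assumption)
  next
    fix A x B y C \<delta> A' x' B' y' C' \<delta>' a b
    assume "tri_in X \<xi> C y B x A \<delta>" "tri_in X \<xi> C' y' B' x' A' \<delta>'"
      and "a \<in> Mor X A' A" "b \<in> Mor X B' B" "x \<cdot>\<^bsub>X\<^esub> b = a \<cdot>\<^bsub>X\<^esub> x'"
    from fill_left[OF this(2,1,4,3) this(5)[symmetric]]
    obtain c where "c \<in> Mor X C' C" "y \<cdot>\<^bsub>X\<^esub> c = b \<cdot>\<^bsub>X\<^esub> y'"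
      and iff: "(\<exists>c'\<in>Mor X B' C. c' \<cdot>\<^bsub>X\<^esub> y' = c) \<longleftrightarrow> (\<exists>a'\<in>Mor X A' B. x \<cdot>\<^bsub>X\<^esub> a' = a)"
      by (metis (no_types, lifting))
    then show "\<exists>c\<in>Mor X C' C. y \<cdot>\<^bsub>X\<^esub> c = b \<cdot>\<^bsub>X\<^esub> y' \<and>
       ((\<exists>a'\<in>Mor X A' B. x \<cdot>\<^bsub>X\<^esub> a' = a) \<longleftrightarrow> (\<exists>c'\<in>Mor X B' C. c' \<cdot>\<^bsub>X\<^esub> y' = c))"
      by - (rule bexI[of _ c], rule conjI, assumption, simp only: iff, assumption)
  qed (use additive_category_axioms in \<open>auto intro: tri_comp_zero weak_kernel weak_cokernel
        tri_zero_left tri_zero_right\<close>)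
qed


section \<open>Exactness and finite projective dimension\<close>

text \<open>These four predicates are the two ends of the covariant and the contravariant Hom
  sequence for one test object \<open>W\<close>. They are kept apart because dimension shifting
  turns one into another.\<close>

definition cov_inj :: "('o, 'm, 'e) extri \<Rightarrow> 'o \<Rightarrow> 'o \<Rightarrow> 'm \<Rightarrow> bool" where
  "cov_inj X W A x \<longleftrightarrow> (\<forall>u\<in>Mor X W A. \<forall>v\<in>Mor X W A. x \<cdot>\<^bsub>X\<^esub> u = x \<cdot>\<^bsub>X\<^esub> v \<longrightarrow> u = v)"

definition cov_surj :: "('o, 'm, 'e) extri \<Rightarrow> 'o \<Rightarrow> 'o \<Rightarrow> 'm \<Rightarrow> 'o \<Rightarrow> bool" where
  "cov_surj X W B y C \<longleftrightarrow> (\<forall>u\<in>Mor X W C. \<exists>v\<in>Mor X W B. y \<cdot>\<^bsub>X\<^esub> v = u)"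

definition contra_inj :: "('o, 'm, 'e) extri \<Rightarrow> 'o \<Rightarrow> 'm \<Rightarrow> 'o \<Rightarrow> bool" where
  "contra_inj X W y C \<longleftrightarrow> (\<forall>u\<in>Mor X C W. \<forall>v\<in>Mor X C W. u \<cdot>\<^bsub>X\<^esub> y = v \<cdot>\<^bsub>X\<^esub> y \<longrightarrow> u = v)"

definition contra_surj :: "('o, 'm, 'e) extri \<Rightarrow> 'o \<Rightarrow> 'o \<Rightarrow> 'm \<Rightarrow> 'o \<Rightarrow> bool" where
  "contra_surj X W A x B \<longleftrightarrow> (\<forall>u\<in>Mor X A W. \<exists>v\<in>Mor X B W. v \<cdot>\<^bsub>X\<^esub> x = u)"

lemma cov_injD: "\<lbrakk>cov_inj X W A x; x \<cdot>\<^bsub>X\<^esub> u = x \<cdot>\<^bsub>X\<^esub> v; u \<in> Mor X W A; v \<in> Mor X W A\<rbrakk> \<Longrightarrow> u = v"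
  by (simp add: cov_inj_def)

lemma cov_surjD: "\<lbrakk>cov_surj X W B y C; u \<in> Mor X W C\<rbrakk> \<Longrightarrow> \<exists>v\<in>Mor X W B. y \<cdot>\<^bsub>X\<^esub> v = u"
  by (simp add: cov_surj_def)

lemma contra_injD:
  "\<lbrakk>contra_inj X W y C; u \<cdot>\<^bsub>X\<^esub> y = v \<cdot>\<^bsub>X\<^esub> y; u \<in> Mor X C W; v \<in> Mor X C W\<rbrakk> \<Longrightarrow> u = v"
  by (simp add: contra_inj_def)

lemma contra_surjD: "\<lbrakk>contra_surj X W A x B; u \<in> Mor X A W\<rbrakk> \<Longrightarrow> \<exists>v\<in>Mor X B W. v \<cdot>\<^bsub>X\<^esub> x = u"
  by (simp add: contra_surj_def)

lemma cov_op_cat [simp]: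
  "cov_inj (op_cat X) W C y \<longleftrightarrow> contra_inj X W y C"
  "cov_surj (op_cat X) W B x A \<longleftrightarrow> contra_surj X W A x B"
  by (simp_all add: cov_inj_def cov_surj_def contra_inj_def contra_surj_def)

context half_exact_class
begin

lemma triD:
  assumes "tri_in X \<xi> A x B y C \<delta>"
  shows "x \<in> Mor X A B" "y \<in> Mor X B C" "A \<in> Obj X" "B \<in> Obj X" "C \<in> Obj X"
  using assms Mor_objD by (auto simp: tri_in_def etriangle_def)

lemma cov_exact_iff:
  assumes T: "tri_in X \<xi> A x B y C \<delta>" and \<W>: "\<W> \<subseteq> Obj X"
  shows "cov_exact X \<W> A x B y C \<longleftrightarrow> (\<forall>W\<in>\<W>. cov_inj X W A x \<and> cov_surj X W B y C)"
proof -
  note D = triD[OF T]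
  have "short_exact_sequence (Hom X W C) (Hom X W B) (Hom X W A) (\<lambda>h. y \<cdot> h) (\<lambda>h. x \<cdot> h)
      \<longleftrightarrow> cov_inj X W A x \<and> cov_surj X W B y C" if "W \<in> \<W>" for W
  proof -
    from that \<W> have W: "W \<in> Obj X" by blast
    have xh: "(\<lambda>h. x \<cdot> h) \<in> hom (Hom X W A) (Hom X W B)"
      and yh: "(\<lambda>h. y \<cdot> h) \<in> hom (Hom X W B) (Hom X W C)"
      using comp_hom_left[OF W] D by blast+
    \<comment> \<open>Middle exactness holds for every triangle: one inclusion is the weak kernel
      property, the other the vanishing composite.\<close>
    have ker: "kernel (Hom X W B) (Hom X W C) (\<lambda>h. y \<cdot> h) = (\<lambda>h. x \<cdot> h) ` Mor X W A"
    proof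
      show "kernel (Hom X W B) (Hom X W C) (\<lambda>h. y \<cdot> h) \<subseteq> (\<lambda>h. x \<cdot> h) ` Mor X W A"
        using weak_kernel[OF T] by (auto simp: kernel_def)
      show "(\<lambda>h. x \<cdot> h) ` Mor X W A \<subseteq> kernel (Hom X W B) (Hom X W C) (\<lambda>h. y \<cdot> h)"
      proof (clarsimp simp: kernel_def, rule conjI)
        fix h assume h: "h \<in> Mor X W A"
        show "x \<cdot> h \<in> Mor X W B" using comp_closed[OF h D(1)] .
        show "y \<cdot> x \<cdot> h = \<one>\<^bsub>Hom X W C\<^esub>"
          using comp_assoc[OF h D(1,2)] tri_comp_zero[OF T] comp_zero_left[OF h D(5)] by simp
      qed
    qed
    have "exact_seq ([Hom X W C, Hom X W B, Hom X W A], [\<lambda>h. y \<cdot> h, \<lambda>h. x \<cdot> h])"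
      using comp_group_hom_left[OF W D(1)] comp_group_hom_left[OF W D(2)] Hom_group[OF W D(5)] yh ker
      by simp
    moreover have "(\<lambda>h. y \<cdot> h) \<in> epi (Hom X W B) (Hom X W C) \<longleftrightarrow> cov_surj X W B y C"
      using yh by (auto simp: epi_iff_subset cov_surj_def subset_iff image_iff eq_commute)
    moreover have "(\<lambda>h. x \<cdot> h) \<in> mon (Hom X W A) (Hom X W B) \<longleftrightarrow> cov_inj X W A x"
      using xh by (simp add: mon_def cov_inj_def inj_on_def)
    ultimately show ?thesis
      unfolding short_exact_sequence_iff by blast
  qed
  then show ?thesis by (auto simp: cov_exact_def)
qed

lemma dual: "half_exact_class (op_cat X) (op_class \<xi>)"
  by (rule half_exact_class_op_cat[OF half_exact_class_axioms])

lemma contra_exact_iff: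
  assumes T: "tri_in X \<xi> A x B y C \<delta>" and \<W>: "\<W> \<subseteq> Obj X"
  shows "contra_exact X \<W> A x B y C \<longleftrightarrow> (\<forall>W\<in>\<W>. contra_inj X W y C \<and> contra_surj X W A x B)"
  using half_exact_class.cov_exact_iff[OF dual, of C y B x A \<delta> \<W>] assms by simp

lemma Proj_subset: "Proj X \<xi> \<subseteq> Obj X" and Inj_subset: "Inj X \<xi> \<subseteq> Obj X"
  by (auto simp: Proj_def Inj_def)

lemma Proj_cov:
  assumes "tri_in X \<xi> A x B y C \<delta>" "P \<in> Proj X \<xi>"
  shows "cov_inj X P A x" "cov_surj X P B y C"
proof -
  have "cov_exact X {P} A x B y C" using assms unfolding Proj_def by blast
  then show "cov_inj X P A x" "cov_surj X P B y C"
    using assms Proj_subset by (auto simp: cov_exact_iff)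
qed

lemma Inj_contra:
  assumes "tri_in X \<xi> A x B y C \<delta>" "I \<in> Inj X \<xi>"
  shows "contra_inj X I y C" "contra_surj X I A x B"
proof -
  have "contra_exact X {I} A x B y C" using assms unfolding Inj_def by blast
  then show "contra_inj X I y C" "contra_surj X I A x B"
    using assms Inj_subset by (auto simp: contra_exact_iff)
qed

lemma zero_cov:
  assumes "zero_object X Z" "tri_in X \<xi> A x B y C \<delta>"
  shows "cov_inj X Z A x" "cov_surj X Z B y C"
proof -
  note D = triD[OF assms(2)]
  have Z: "Z \<in> Obj X" using assms(1) by (simp add: zero_object_def)
  show "cov_inj X Z A x"
    using Mor_zero_left[OF assms(1)] unfolding cov_inj_def by metis
  show "cov_surj X Z B y C"
    unfolding cov_surj_def
  proof
    fix u assume "u \<in> Mor X Z C"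
    then have "y \<cdot> \<one>\<^bsub>Hom X Z B\<^esub> = u"
      using Mor_zero_left[OF assms(1)] comp_zero_right[OF Z D(2)] by simp
    then show "\<exists>v\<in>Mor X Z B. y \<cdot> v = u" using zero_closed[OF Z D(4)] by blast
  qed
qed

lemma zero_contra:
  assumes "zero_object X Z" "tri_in X \<xi> A x B y C \<delta>"
  shows "contra_inj X Z y C" "contra_surj X Z A x B"
  using half_exact_class.zero_cov[OF dual, of Z C y B x A \<delta>] assms by simp_all

text \<open>\<open>u \<cdot> y\<close> lifts because maps from \<open>B\<close> do; the induced map
  from \<open>A\<close> to \<open>A'\<close> extends along \<open>x\<close>, and by
  \<open>fill_left\<close> this is equivalent to \<open>u\<close> having a lift. The four lemmas of
  this kind pass from the middle term of one triangle to its last term, at the price of a condition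
  on a first term.\<close>

lemma cov_surj_quotient:
  assumes T: "tri_in X \<xi> A x B y C \<delta>" and T': "tri_in X \<xi> A' x' B' y' C' \<delta>'"
    and B: "cov_surj X B B' y' C'" and A': "contra_surj X A' A x B"
  shows "cov_surj X C B' y' C'"
  unfolding cov_surj_def
proof
  fix u assume u: "u \<in> Mor X C C'"
  note D = triD[OF T]
  obtain b where b: "b \<in> Mor X B B'" "y' \<cdot> b = u \<cdot> y"
    using cov_surjD[OF B comp_closed[OF D(2) u]] by blast
  from fill_left[OF T T' b(1) u b(2)[symmetric]] contra_surjD[OF A']
  show "\<exists>v\<in>Mor X C B'. y' \<cdot> v = u" by blast
qed

lemma cov_inj_quotient:
  assumes T: "tri_in X \<xi> A x B y C \<delta>" and T': "tri_in X \<xi> A' x' B' y' C' \<delta>'"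
    and B: "cov_inj X B A' x'" and A': "contra_inj X A' y C"
  shows "cov_inj X C A' x'"
  unfolding cov_inj_def
proof (intro ballI impI)
  fix u v assume uv: "u \<in> Mor X C A'" "v \<in> Mor X C A'" "x' \<cdot> u = x' \<cdot> v"
  note D = triD[OF T] triD[OF T']
  have "x' \<cdot> (u \<cdot> y) = x' \<cdot> (v \<cdot> y)"
    using comp_assoc[OF D(2) uv(1) D(6)] comp_assoc[OF D(2) uv(2) D(6)] uv(3) by simp
  then have "u \<cdot> y = v \<cdot> y"
    using cov_injD[OF B] comp_closed[OF D(2)] uv by blast
  then show "u = v" using contra_injD[OF A'] uv by blast
qed

lemma contra_surj_quotient:
  assumes T: "tri_in X \<xi> A x B y C \<delta>" and T': "tri_in X \<xi> A' x' B' y' C' \<delta>'"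
    and A: "cov_surj X A B' y' C'" and B': "contra_surj X B' A x B"
  shows "contra_surj X C' A x B"
  unfolding contra_surj_def
proof
  fix u assume "u \<in> Mor X A C'"
  then obtain w where w: "w \<in> Mor X A B'" "y' \<cdot> w = u"
    using cov_surjD[OF A] by blast
  then obtain v where v: "v \<in> Mor X B B'" "v \<cdot> x = w"
    using contra_surjD[OF B'] by blast
  note D = triD[OF T] triD[OF T']
  have "(y' \<cdot> v) \<cdot> x = u"
    using comp_assoc[OF D(1) v(1) D(7)] v w by simp
  then show "\<exists>v\<in>Mor X B C'. v \<cdot> x = u" using comp_closed[OF v(1) D(7)] by blast
qed

text \<open>Let \<open>u\<close> be killed by \<open>y\<close> and lift it to \<open>u'\<close>
  through \<open>y'\<close>. Then \<open>u' \<cdot> y\<close> factors through \<open>x'\<close> by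
  some \<open>v\<close>; injectivity on \<open>A\<close> gives \<open>v \<cdot> x\<close> = 0, so
  \<open>v\<close> descends to \<open>w\<close> on \<open>C\<close>. Cancelling \<open>y\<close> in
  maps to \<open>B'\<close> gives \<open>u' = x' \<cdot> w\<close>, and \<open>y'\<close> kills
  this.\<close>

lemma contra_inj_quotient:
  assumes T: "tri_in X \<xi> A x B y C \<delta>" and T': "tri_in X \<xi> A' x' B' y' C' \<delta>'"
    and A: "cov_inj X A A' x'" and C: "cov_surj X C B' y' C'" and B': "contra_inj X B' y C"
  shows "contra_inj X C' y C"
proof -
  note D = triD[OF T] triD[OF T']
  have zero: "u = \<one>\<^bsub>Hom X C C'\<^esub>" if u: "u \<in> Mor X C C'" "u \<cdot> y = \<one>\<^bsub>Hom X B C'\<^esub>" for u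
  proof -
    obtain u' where u': "u' \<in> Mor X C B'" "y' \<cdot> u' = u" using cov_surjD[OF C u(1)] by blast
    have u'y: "u' \<cdot> y \<in> Mor X B B'" using comp_closed[OF D(2) u'(1)] .
    have "y' \<cdot> (u' \<cdot> y) = \<one>\<^bsub>Hom X B C'\<^esub>"
      using comp_assoc[OF D(2) u'(1) D(7)] u u' by simp
    then obtain v where v: "v \<in> Mor X B A'" "u' \<cdot> y = x' \<cdot> v"
      using weak_kernel[OF T' u'y] by blast
    have "x' \<cdot> (v \<cdot> x) = u' \<cdot> (y \<cdot> x)"
      using comp_assoc[OF D(1) v(1) D(6)] comp_assoc[OF D(1,2) u'(1)] v by simp
    also have "\<dots> = \<one>\<^bsub>Hom X A B'\<^esub>"
      using tri_comp_zero[OF T] comp_zero_right[OF D(3) u'(1)] by simp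
    also have "\<dots> = x' \<cdot> \<one>\<^bsub>Hom X A A'\<^esub>"
      using comp_zero_right[OF D(3) D(6)] by simp
    finally have "v \<cdot> x = \<one>\<^bsub>Hom X A A'\<^esub>"
      using cov_injD[OF A] comp_closed[OF D(1) v(1)] D zero_closed by blast
    then obtain w where w: "w \<in> Mor X C A'" "v = w \<cdot> y"
      using weak_cokernel[OF T v(1)] by blast
    have "u' \<cdot> y = (x' \<cdot> w) \<cdot> y"
      using comp_assoc[OF D(2) w(1) D(6)] v w by simp
    then have "u' = x' \<cdot> w"
      using contra_injD[OF B'] u' comp_closed[OF w(1) D(6)] by blast
    then have "u = (y' \<cdot> x') \<cdot> w"
      using comp_assoc[OF w(1) D(6,7)] u' by simp
    then show ?thesis
      using tri_comp_zero[OF T'] comp_zero_left[OF w(1) D(10)] by simp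
  qed
  interpret group_hom "Hom X C C'" "Hom X B C'" "\<lambda>g. g \<cdot> y"
    by (rule comp_group_hom_right[OF D(2,10)])
  have "inj_on (\<lambda>g. g \<cdot> y) (Mor X C C')"
    using zero by (simp add: inj_on_one_iff)
  then show ?thesis by (auto simp: contra_inj_def inj_on_def)
qed

section \<open>Dimension shifting along complete resolutions\<close>

lemma complete_proj_resolutionD:
  assumes "complete_proj_resolution X \<xi> V d K g f \<delta>"
  shows "tri_in X \<xi> (K (n + 1)) (g n) (V n) (f n) (K n) (\<delta> n)" "V n \<in> Proj X \<xi>"
    "P \<in> Proj X \<xi> \<Longrightarrow> contra_inj X P (f n) (K n)"
    "P \<in> Proj X \<xi> \<Longrightarrow> contra_surj X P (K (n + 1)) (g n) (V n)"
proof -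
  show T: "tri_in X \<xi> (K (n + 1)) (g n) (V n) (f n) (K n) (\<delta> n)" and "V n \<in> Proj X \<xi>"
    using assms by (auto simp: complete_proj_resolution_def xi_exact_complex_def)
  show "P \<in> Proj X \<xi> \<Longrightarrow> contra_inj X P (f n) (K n)"
    "P \<in> Proj X \<xi> \<Longrightarrow> contra_surj X P (K (n + 1)) (g n) (V n)"
    using assms contra_exact_iff[OF T Proj_subset] by (auto simp: complete_proj_resolution_def)
qed

lemma complete_inj_coresolutionD:
  assumes "complete_inj_coresolution X \<xi> V d K g f \<delta>"
  shows "tri_in X \<xi> (K (n + 1)) (g n) (V n) (f n) (K n) (\<delta> n)" "V n \<in> Inj X \<xi>"
    "I \<in> Inj X \<xi> \<Longrightarrow> cov_inj X I (K (n + 1)) (g n)"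
    "I \<in> Inj X \<xi> \<Longrightarrow> cov_surj X I (V n) (f n) (K n)"
proof -
  show T: "tri_in X \<xi> (K (n + 1)) (g n) (V n) (f n) (K n) (\<delta> n)" and "V n \<in> Inj X \<xi>"
    using assms by (auto simp: complete_inj_coresolution_def xi_exact_complex_def)
  show "I \<in> Inj X \<xi> \<Longrightarrow> cov_inj X I (K (n + 1)) (g n)"
    "I \<in> Inj X \<xi> \<Longrightarrow> cov_surj X I (V n) (f n) (K n)"
    using assms cov_exact_iff[OF T Inj_subset] by (auto simp: complete_inj_coresolution_def)
qed

text \<open>Induction on the dimension, for all positions \<open>n\<close> at once: the claim at
  \<open>n\<close> in the inductive step draws on the lifting property of the next syzygy
  \<open>K (n + 1)\<close>.\<close>

lemma complete_proj_resolution_pd_le: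
  assumes "pd_le X \<xi> m Y" and R: "complete_proj_resolution X \<xi> V d K g f \<delta>"
  shows "contra_inj X Y (f n) (K n) \<and> contra_surj X Y (K (n + 1)) (g n) (V n)"
  using assms(1)
proof (induction arbitrary: n rule: pd_le.induct)
  case (zero A)
  then show ?case using zero_contra[OF _ complete_proj_resolutionD(1)[OF R]] by blast
next
  case (proj A)
  then show ?case using complete_proj_resolutionD(3,4)[OF R] by blast
next
  case (step K' x P y A \<epsilon>)
  note T = complete_proj_resolutionD(1)[OF R] and V = complete_proj_resolutionD(2)[OF R]
  \<comment> \<open>Projective \<open>V n\<close> sees the triangle over \<open>A\<close> as exact,
    and the induction hypothesis for \<open>K'\<close> hands this on to the quotient
    \<open>K n\<close>.\<close>
  have cov: "cov_inj X (K n) K' x" "cov_surj X (K n) P y A" for n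
    using cov_inj_quotient[OF T step.hyps(1) Proj_cov(1)[OF step.hyps(1) V]]
      cov_surj_quotient[OF T step.hyps(1) Proj_cov(2)[OF step.hyps(1) V]] step.IH by blast+
  show ?case
    using contra_inj_quotient[OF T step.hyps(1) cov(1,2) complete_proj_resolutionD(3)[OF R step.hyps(2)]]
      contra_surj_quotient[OF T step.hyps(1) cov(2) complete_proj_resolutionD(4)[OF R step.hyps(2)]]
    by blast
qed

lemma GP_cov_pd_finite:
  assumes T: "tri_in X \<xi> A x B y C \<delta>" and A: "pd_finite X \<xi> A" and W: "W \<in> GP X \<xi>"
  shows "cov_inj X W A x" "cov_surj X W B y C"
proof -
  obtain V d K g f \<epsilon> n where Wn: "W = K n" and R: "complete_proj_resolution X \<xi> V d K g f \<epsilon>"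
    using W unfolding GP_def by blast
  obtain m where m: "pd_le X \<xi> m A" using A by (auto simp: pd_finite_def)
  note L = complete_proj_resolution_pd_le[OF m R, of n]
    and S = complete_proj_resolutionD(1)[OF R, of n]
    and P = Proj_cov[OF T complete_proj_resolutionD(2)[OF R, of n]]
  show "cov_inj X W A x" "cov_surj X W B y C"
    using cov_inj_quotient[OF S T P(1)] cov_surj_quotient[OF S T P(2)] L Wn by blast+
qed

text \<open>This is not dual to \<open>complete_proj_resolution_pd_le\<close>, since projective
  dimension meets an injective coresolution. The base case is immediate, as projectives see every
  triangle of the class as exact.\<close>

lemma complete_inj_coresolution_pd_le:
  assumes "pd_le X \<xi> m Y" and R: "complete_inj_coresolution X \<xi> V d K g f \<delta>"
  shows "cov_inj X Y (K (n + 1)) (g n) \<and> cov_surj X Y (V n) (f n) (K n)"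
  using assms(1)
proof (induction arbitrary: n rule: pd_le.induct)
  case (zero A)
  then show ?case using zero_cov[OF _ complete_inj_coresolutionD(1)[OF R]] by blast
next
  case (proj A)
  then show ?case using Proj_cov[OF complete_inj_coresolutionD(1)[OF R]] by blast
next
  case (step K' x P y A \<epsilon>)
  note T = step.hyps(1) and S = complete_inj_coresolutionD(1)[OF R]
    and V = complete_inj_coresolutionD(2)[OF R]
  \<comment> \<open>The three facts depend on each other across degrees: \<open>lift\<close> at
    \<open>n\<close> uses \<open>ext\<close> at \<open>n + 1\<close>, \<open>epi\<close> at
    \<open>n\<close> uses \<open>lift\<close> at \<open>n\<close>, and the conclusion at
    \<open>n\<close> uses \<open>epi\<close> at \<open>n + 1\<close>.\<close>
  have ext: "contra_surj X (K n) K' x P" for n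
    using contra_surj_quotient[OF T S _ Inj_contra(2)[OF T V]] step.IH by blast
  have lift: "cov_surj X A (V n) (f n) (K n)" for n
    by (rule cov_surj_quotient[OF T S Proj_cov(2)[OF S step.hyps(2)] ext])
  have epi: "contra_inj X (K n) y A" for n
    using contra_inj_quotient[OF T S _ lift Inj_contra(1)[OF T V]] step.IH by blast
  show ?case
    using cov_inj_quotient[OF T S Proj_cov(1)[OF S step.hyps(2)] epi] lift by blast
qed

text \<open>Surjectivity needs finite dimension only of the first term. The chase for injectivity
  also lifts maps out of \<open>C\<close>, hence the additional premise of the second claim.\<close>

lemma GI_contra_pd_finite:
  assumes T: "tri_in X \<xi> A x B y C \<delta>" and A: "pd_finite X \<xi> A" and M: "M \<in> GI X \<xi>"
  shows "contra_surj X M A x B" "pd_finite X \<xi> C \<Longrightarrow> contra_inj X M y C"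
proof -
  obtain V d K g f \<epsilon> n where Mn: "M = K n" and R: "complete_inj_coresolution X \<xi> V d K g f \<epsilon>"
    using M unfolding GI_def by blast
  obtain m where m: "pd_le X \<xi> m A" using A by (auto simp: pd_finite_def)
  note L = complete_inj_coresolution_pd_le[OF m R, of n]
    and S = complete_inj_coresolutionD(1)[OF R, of n]
    and I = Inj_contra[OF T complete_inj_coresolutionD(2)[OF R, of n]]
  show "contra_surj X M A x B"
    using contra_surj_quotient[OF T S _ I(2)] L Mn by blast
  assume "pd_finite X \<xi> C"
  then obtain k where k: "pd_le X \<xi> k C" by (auto simp: pd_finite_def)
  show "contra_inj X M y C"
    using contra_inj_quotient[OF T S _ _ I(1)] L complete_inj_coresolution_pd_le[OF k R, of n] Mn
    by blast
qed

end


section \<open>Comparison of resolutions\<close>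

text \<open>Resolutions are augmented: \<open>P 0\<close> is the resolved object and \<open>d 0\<close> the augmentation.\<close>

definition relative_resolution ::
  "('o, 'm, 'e) extri \<Rightarrow> 'o set \<Rightarrow> (nat \<Rightarrow> 'o) \<Rightarrow> (nat \<Rightarrow> 'm) \<Rightarrow> bool" where
  "relative_resolution X \<W> P d \<longleftrightarrow> (\<forall>i. P (Suc i) \<in> \<W> \<and> d i \<in> Mor X (P (Suc i)) (P i) \<and>
     d i \<cdot>\<^bsub>X\<^esub> d (Suc i) = \<one>\<^bsub>Hom X (P (Suc (Suc i))) (P i)\<^esub> \<and>
     (\<forall>W\<in>\<W>. \<forall>u\<in>Mor X W (P i).
        (case i of 0 \<Rightarrow> True | Suc j \<Rightarrow> d j \<cdot>\<^bsub>X\<^esub> u = \<one>\<^bsub>Hom X W (P j)\<^esub>)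
        \<longrightarrow> (\<exists>v\<in>Mor X W (P (Suc i)). u = d i \<cdot>\<^bsub>X\<^esub> v)))"

definition contra_acyclic ::
  "('o, 'm, 'e) extri \<Rightarrow> (nat \<Rightarrow> 'o) \<Rightarrow> (nat \<Rightarrow> 'm) \<Rightarrow> 'o \<Rightarrow> bool" where
  "contra_acyclic X P d M \<longleftrightarrow>
     (\<forall>u\<in>Mor X (P 0) M. u \<cdot>\<^bsub>X\<^esub> d 0 = \<one>\<^bsub>Hom X (P (Suc 0)) M\<^esub> \<longrightarrow> u = \<one>\<^bsub>Hom X (P 0) M\<^esub>) \<and>
     (\<forall>i. \<forall>u\<in>Mor X (P (Suc i)) M. u \<cdot>\<^bsub>X\<^esub> d (Suc i) = \<one>\<^bsub>Hom X (P (Suc (Suc i))) M\<^esub>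
        \<longrightarrow> (\<exists>v\<in>Mor X (P i) M. u = v \<cdot>\<^bsub>X\<^esub> d i))"

lemma relative_resolutionD:
  assumes "relative_resolution X \<W> P d"
  shows "P (Suc i) \<in> \<W>" "d i \<in> Mor X (P (Suc i)) (P i)"
    "d i \<cdot>\<^bsub>X\<^esub> d (Suc i) = \<one>\<^bsub>Hom X (P (Suc (Suc i))) (P i)\<^esub>"
    "\<lbrakk>W \<in> \<W>; u \<in> Mor X W (P 0)\<rbrakk> \<Longrightarrow> \<exists>v\<in>Mor X W (P (Suc 0)). u = d 0 \<cdot>\<^bsub>X\<^esub> v"
    "\<lbrakk>W \<in> \<W>; u \<in> Mor X W (P (Suc i)); d i \<cdot>\<^bsub>X\<^esub> u = \<one>\<^bsub>Hom X W (P i)\<^esub>\<rbrakk>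
      \<Longrightarrow> \<exists>v\<in>Mor X W (P (Suc (Suc i))). u = d (Suc i) \<cdot>\<^bsub>X\<^esub> v"
  using assms unfolding relative_resolution_def
  by (blast, blast, blast, force dest: spec[of _ 0], force dest: spec[of _ "Suc i"])

context half_exact_class
begin

context
  fixes \<W> :: "'o set" and P :: "nat \<Rightarrow> 'o" and d :: "nat \<Rightarrow> 'm"
  assumes R: "relative_resolution X \<W> P d"
begin

lemma res_mor: "d i \<in> Mor X (P (Suc i)) (P i)"
  by (rule relative_resolutionD(2)[OF R])

lemma res_obj: "P i \<in> Obj X"
  using Mor_objD(2)[OF res_mor] .

lemma res_exact_diff:
  assumes W: "W \<in> \<W>" and a: "a \<in> Mor X W (P (Suc i))" and b: "b \<in> Mor X W (P (Suc i))"
    and eq: "d i \<cdot> a = d i \<cdot> b"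
  shows "\<exists>v\<in>Mor X W (P (Suc (Suc i))). a = b \<otimes>\<^bsub>Hom X W (P (Suc i))\<^esub> (d (Suc i) \<cdot> v)"
proof -
  have WO: "W \<in> Obj X" using Mor_objD(1)[OF a] .
  interpret G: comm_group "Hom X W (P (Suc i))" by (rule Hom_comm_group[OF WO res_obj])
  interpret h: group_hom "Hom X W (P (Suc i))" "Hom X W (P i)" "\<lambda>u. d i \<cdot> u"
    by (rule comp_group_hom_left[OF WO res_mor])
  let ?u = "inv\<^bsub>Hom X W (P (Suc i))\<^esub> b \<otimes>\<^bsub>Hom X W (P (Suc i))\<^esub> a"
  have u: "?u \<in> Mor X W (P (Suc i))" using a b by simp
  have "d i \<cdot> ?u = \<one>\<^bsub>Hom X W (P i)\<^esub>"
    using a b eq h.hom_closed[OF b] by simp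
  then obtain v where v: "v \<in> Mor X W (P (Suc (Suc i)))" "?u = d (Suc i) \<cdot> v"
    using relative_resolutionD(5)[OF R W u] by blast
  have "a = b \<otimes>\<^bsub>Hom X W (P (Suc i))\<^esub> ?u"
    using a b by (simp add: G.m_assoc[symmetric])
  with v show ?thesis by auto
qed

text \<open>The homotopy is stated as a sum that equals the identity, which keeps inverses out of
  later computations.\<close>

lemma homotopic_to_Id:
  assumes \<theta>: "\<And>i. \<theta> i \<in> Mor X (P i) (P i)" and \<theta>0: "\<theta> 0 = Id X (P 0)"
    and chain: "\<And>i. d i \<cdot> \<theta> (Suc i) = \<theta> i \<cdot> d i"
  shows "\<exists>s. \<forall>i. s i \<in> Mor X (P i) (P (Suc i)) \<and>
    Id X (P (Suc i)) = \<theta> (Suc i) \<otimes>\<^bsub>Hom X (P (Suc i)) (P (Suc i))\<^esub>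
      ((s i \<cdot> d i) \<otimes>\<^bsub>Hom X (P (Suc i)) (P (Suc i))\<^esub> (d (Suc i) \<cdot> s (Suc i)))"
proof -
  let ?H = "\<lambda>i. Hom X (P i) (P i)"
  \<comment> \<open>\<open>?A\<close> is the invariant that allows the next lift: it makes
    \<open>\<theta> (Suc n)\<close> plus \<open>s \<cdot> d n\<close> agree with the identity after
    composition with \<open>d n\<close>. \<open>?B\<close> is the homotopy equation linking
    consecutive choices.\<close>
  let ?A = "\<lambda>n s. s \<in> Mor X (P n) (P (Suc n)) \<and> d n = (\<theta> n \<otimes>\<^bsub>?H n\<^esub> (d n \<cdot> s)) \<cdot> d n"
  let ?B = "\<lambda>n s s'. Id X (P (Suc n)) = \<theta> (Suc n) \<otimes>\<^bsub>?H (Suc n)\<^esub>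
      ((s \<cdot> d n) \<otimes>\<^bsub>?H (Suc n)\<^esub> (d (Suc n) \<cdot> s'))"
  have "\<exists>s. \<forall>n. ?A n (s n) \<and> ?B n (s n) (s (Suc n))"
  proof (rule dependent_nat_choice)
    interpret group "?H 0" by (rule Hom_group[OF res_obj res_obj])
    \<comment> \<open>The homotopy starts at zero, since \<open>\<theta> 0\<close> is already the
      identity.\<close>
    have "?A 0 \<one>\<^bsub>Hom X (P 0) (P (Suc 0))\<^esub>"
      using comp_zero_right[OF res_obj res_mor, of 0 0] Id_left[OF res_mor, of 0]
        Id_closed[OF res_obj, of 0] \<theta>0 res_obj by simp
    then show "\<exists>s. ?A 0 s" by blast
  next
    fix s n assume s: "?A n s"
    interpret G: comm_group "?H (Suc n)" by (rule Hom_comm_group[OF res_obj res_obj])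
    have sd: "s \<cdot> d n \<in> Mor X (P (Suc n)) (P (Suc n))"
      using comp_closed[OF res_mor] s by blast
    let ?b = "\<theta> (Suc n) \<otimes>\<^bsub>?H (Suc n)\<^esub> (s \<cdot> d n)"
    have b: "?b \<in> Mor X (P (Suc n)) (P (Suc n))" using \<theta> sd by simp
    have ds: "d n \<cdot> s \<in> Mor X (P n) (P n)" using comp_closed[OF _ res_mor] s by blast
    have "d n \<cdot> ?b = (d n \<cdot> \<theta> (Suc n)) \<otimes>\<^bsub>Hom X (P (Suc n)) (P n)\<^esub> (d n \<cdot> (s \<cdot> d n))"
      by (rule comp_add_right[OF \<theta> sd res_mor])
    also have "\<dots> = (\<theta> n \<cdot> d n) \<otimes>\<^bsub>Hom X (P (Suc n)) (P n)\<^esub> ((d n \<cdot> s) \<cdot> d n)"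
      using chain comp_assoc[OF res_mor _ res_mor] s by simp
    also have "\<dots> = (\<theta> n \<otimes>\<^bsub>?H n\<^esub> (d n \<cdot> s)) \<cdot> d n"
      using comp_add_left[OF res_mor \<theta> ds] by simp
    also have "\<dots> = d n" using s by simp
    finally have "d n \<cdot> Id X (P (Suc n)) = d n \<cdot> ?b" using Id_right[OF res_mor] by simp
    then obtain s' where s': "s' \<in> Mor X (P (Suc n)) (P (Suc (Suc n)))"
      and Id: "Id X (P (Suc n)) = ?b \<otimes>\<^bsub>?H (Suc n)\<^esub> (d (Suc n) \<cdot> s')"
      using res_exact_diff[OF relative_resolutionD(1)[OF R] Id_closed[OF res_obj] b] by blast
    have ds': "d (Suc n) \<cdot> s' \<in> Mor X (P (Suc n)) (P (Suc n))" using comp_closed[OF s' res_mor] .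
    let ?K = "Hom X (P (Suc (Suc n))) (P (Suc n))"
    interpret K: comm_group ?K by (rule Hom_comm_group[OF res_obj res_obj])
    have "s \<cdot> d n \<cdot> d (Suc n) = \<one>\<^bsub>?K\<^esub>"
      using relative_resolutionD(3)[OF R, of n] comp_zero_right[OF res_obj, of s] s by simp
    then have sdd: "(s \<cdot> d n) \<cdot> d (Suc n) = \<one>\<^bsub>?K\<^esub>"
      using comp_assoc[OF res_mor res_mor conjunct1[OF s]] by simp
    have "d (Suc n) = (?b \<otimes>\<^bsub>?H (Suc n)\<^esub> (d (Suc n) \<cdot> s')) \<cdot> d (Suc n)"
      by (simp only: Id[symmetric] Id_left[OF res_mor])
    also have "\<dots> = (\<theta> (Suc n) \<cdot> d (Suc n)) \<otimes>\<^bsub>?K\<^esub> ((s \<cdot> d n) \<cdot> d (Suc n))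
        \<otimes>\<^bsub>?K\<^esub> ((d (Suc n) \<cdot> s') \<cdot> d (Suc n))"
      using comp_add_left[OF res_mor b ds'] comp_add_left[OF res_mor \<theta> sd] by simp
    also have "\<dots> = (\<theta> (Suc n) \<otimes>\<^bsub>?H (Suc n)\<^esub> (d (Suc n) \<cdot> s')) \<cdot> d (Suc n)"
      using sdd comp_closed[OF res_mor \<theta>] comp_add_left[OF res_mor \<theta> ds'] by simp
    finally have "?A (Suc n) s'" using s' by blast
    moreover have "?B n s s'"
      using Id \<theta> sd ds' by (simp add: G.m_assoc)
    ultimately show "\<exists>s'. ?A (Suc n) s' \<and> ?B n s s'" by blast
  qed
  then show ?thesis by blast
qed

end

lemma comparison:
  assumes R: "relative_resolution X \<W> P d" and R': "relative_resolution X \<W> P' d'"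
    and eq: "P 0 = P' 0"
  shows "\<exists>\<phi>. \<phi> 0 = Id X (P 0) \<and> (\<forall>i. \<phi> i \<in> Mor X (P i) (P' i)) \<and>
    (\<forall>i. d' i \<cdot> \<phi> (Suc i) = \<phi> i \<cdot> d i)"
proof -
  note m = res_mor[OF R] and m' = res_mor[OF R']
  \<comment> \<open>In positive degrees the choice must remember that \<open>x \<cdot> d n\<close>
    is a cycle, since only cycles lift; in degree 0 every map from a test object lifts.\<close>
  let ?A = "\<lambda>n x. x \<in> Mor X (P n) (P' n) \<and> (case n of 0 \<Rightarrow> x = Id X (P 0)
    | Suc j \<Rightarrow> d' j \<cdot> (x \<cdot> d n) = \<one>\<^bsub>Hom X (P (Suc n)) (P' j)\<^esub>)"
  have "\<exists>\<phi>. \<forall>n. ?A n (\<phi> n) \<and> d' n \<cdot> \<phi> (Suc n) = \<phi> n \<cdot> d n"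
  proof (rule dependent_nat_choice)
    have "?A 0 (Id X (P 0))" using Id_closed[OF res_obj[OF R], of 0] eq by simp
    then show "\<exists>x. ?A 0 x" by blast
  next
    fix x n assume x: "?A n x"
    then have xd: "x \<cdot> d n \<in> Mor X (P (Suc n)) (P' n)" using comp_closed[OF m] by blast
    have "\<exists>v\<in>Mor X (P (Suc n)) (P' (Suc n)). x \<cdot> d n = d' n \<cdot> v"
    proof (cases n)
      case 0
      then show ?thesis
        using relative_resolutionD(4)[OF R' relative_resolutionD(1)[OF R]] xd by blast
    next
      case (Suc j)
      then show ?thesis
        using relative_resolutionD(5)[OF R' relative_resolutionD(1)[OF R, of n], of "x \<cdot> d n" j] x xd by simp
    qed
    then obtain v where v: "v \<in> Mor X (P (Suc n)) (P' (Suc n))" "d' n \<cdot> v = x \<cdot> d n" by metis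
    have "d' n \<cdot> (v \<cdot> d (Suc n)) = x \<cdot> (d n \<cdot> d (Suc n))"
      using comp_assoc[OF m v(1) m'] comp_assoc[OF m m conjunct1[OF x]] v by simp
    also have "\<dots> = \<one>\<^bsub>Hom X (P (Suc (Suc n))) (P' n)\<^esub>"
      using relative_resolutionD(3)[OF R] comp_zero_right[OF res_obj[OF R]] x by simp
    finally have "?A (Suc n) v" using v by simp
    with v show "\<exists>v. ?A (Suc n) v \<and> d' n \<cdot> v = x \<cdot> d n" by blast
  qed
  then obtain \<phi> where \<phi>: "\<forall>n. ?A n (\<phi> n) \<and> d' n \<cdot> \<phi> (Suc n) = \<phi> n \<cdot> d n" by blast
  have "\<phi> 0 = Id X (P 0)" using spec[OF \<phi>, of 0] by simp
  with \<phi> show ?thesis by blast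
qed

text \<open>A cocycle \<open>u\<close> on \<open>P\<close> becomes a coboundary
  \<open>v \<cdot> d' i\<close> after composition with \<psi>. Composing back with \<phi> and
  inserting the homotopy between \<psi>\<phi> and the identity writes \<open>u\<close> as
  \<open>v \<cdot> \<phi> i\<close> plus \<open>u \<cdot> s i\<close>, followed by
  \<open>d i\<close>.\<close>

lemma contra_acyclic_transfer:
  assumes R: "relative_resolution X \<W> P d" and R': "relative_resolution X \<W> P' d'"
    and eq: "P 0 = P' 0" and ac: "contra_acyclic X P' d' M" and M: "M \<in> Obj X"
  shows "contra_acyclic X P d M"
proof -
  note m = res_mor[OF R] and m' = res_mor[OF R'] and o = res_obj[OF R] and o' = res_obj[OF R']
  obtain \<phi> where \<phi>: "\<phi> 0 = Id X (P 0)" "\<And>i. \<phi> i \<in> Mor X (P i) (P' i)"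
    "\<And>i. d' i \<cdot> \<phi> (Suc i) = \<phi> i \<cdot> d i"
    using comparison[OF R R' eq] by blast
  obtain \<psi> where \<psi>: "\<psi> 0 = Id X (P' 0)" "\<And>i. \<psi> i \<in> Mor X (P' i) (P i)"
    "\<And>i. d i \<cdot> \<psi> (Suc i) = \<psi> i \<cdot> d' i"
    using comparison[OF R' R eq[symmetric]] by blast
  have \<theta>: "\<psi> i \<cdot> \<phi> i \<in> Mor X (P i) (P i)" for i by (rule comp_closed[OF \<phi>(2) \<psi>(2)])
  have "\<psi> 0 \<cdot> \<phi> 0 = Id X (P 0)" using \<phi>(1) \<psi>(1) eq Id_left[OF Id_closed[OF o]] by metis
  moreover have "d i \<cdot> (\<psi> (Suc i) \<cdot> \<phi> (Suc i)) = (\<psi> i \<cdot> \<phi> i) \<cdot> d i" for i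
  proof -
    have "d i \<cdot> (\<psi> (Suc i) \<cdot> \<phi> (Suc i)) = (\<psi> i \<cdot> d' i) \<cdot> \<phi> (Suc i)"
      using comp_assoc[OF \<phi>(2) \<psi>(2) m] \<psi>(3) by simp
    also have "\<dots> = (\<psi> i \<cdot> \<phi> i) \<cdot> d i"
      using comp_assoc[OF \<phi>(2) m' \<psi>(2)] comp_assoc[OF m \<phi>(2) \<psi>(2)] \<phi>(3) by simp
    finally show ?thesis .
  qed
  ultimately obtain s where s: "\<And>i. s i \<in> Mor X (P i) (P (Suc i))"
    "\<And>i. Id X (P (Suc i)) = (\<psi> (Suc i) \<cdot> \<phi> (Suc i)) \<otimes>\<^bsub>Hom X (P (Suc i)) (P (Suc i))\<^esub>
      ((s i \<cdot> d i) \<otimes>\<^bsub>Hom X (P (Suc i)) (P (Suc i))\<^esub> (d (Suc i) \<cdot> s (Suc i)))"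
    using homotopic_to_Id[OF R, of "\<lambda>i. \<psi> i \<cdot> \<phi> i"] \<theta> by metis
  show ?thesis
    unfolding contra_acyclic_def
  proof (intro conjI allI ballI impI)
    fix u assume u: "u \<in> Mor X (P 0) M" "u \<cdot> d 0 = \<one>\<^bsub>Hom X (P (Suc 0)) M\<^esub>"
    have "d' 0 = d 0 \<cdot> \<psi> (Suc 0)" using \<psi>(1) \<psi>(3)[of 0] Id_left[OF m'] by simp
    then have "u \<cdot> d' 0 = \<one>\<^bsub>Hom X (P' (Suc 0)) M\<^esub>"
      using comp_assoc[OF \<psi>(2) m u(1)] u(2) comp_zero_left[OF \<psi>(2) M] by simp
    then show "u = \<one>\<^bsub>Hom X (P 0) M\<^esub>"
      using ac u(1) eq by (simp add: contra_acyclic_def)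
  next
    fix i u assume u: "u \<in> Mor X (P (Suc i)) M" "u \<cdot> d (Suc i) = \<one>\<^bsub>Hom X (P (Suc (Suc i))) M\<^esub>"
    let ?H = "Hom X (P (Suc i)) M"
    interpret H: comm_group ?H by (rule Hom_comm_group[OF o M])
    have "(u \<cdot> \<psi> (Suc i)) \<cdot> d' (Suc i) = \<one>\<^bsub>Hom X (P' (Suc (Suc i))) M\<^esub>"
      using comp_assoc[OF m' \<psi>(2) u(1)] \<psi>(3)[of "Suc i", symmetric] comp_assoc[OF \<psi>(2) m u(1)] u(2)
        comp_zero_left[OF \<psi>(2) M] by simp
    then obtain v where v: "v \<in> Mor X (P' i) M" "u \<cdot> \<psi> (Suc i) = v \<cdot> d' i"
      using ac comp_closed[OF \<psi>(2) u(1)] unfolding contra_acyclic_def by blast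
    have sd: "s i \<cdot> d i \<in> Mor X (P (Suc i)) (P (Suc i))"
      and ds: "d (Suc i) \<cdot> s (Suc i) \<in> Mor X (P (Suc i)) (P (Suc i))"
      using comp_closed[OF m s(1)] comp_closed[OF s(1) m] by blast+
    interpret G: comm_group "Hom X (P (Suc i)) (P (Suc i))" by (rule Hom_comm_group[OF o o])
    have 1: "u \<cdot> (\<psi> (Suc i) \<cdot> \<phi> (Suc i)) = (v \<cdot> \<phi> i) \<cdot> d i"
      using comp_assoc[OF \<phi>(2) \<psi>(2) u(1)] comp_assoc[OF \<phi>(2) m' v(1)] comp_assoc[OF m \<phi>(2) v(1)]
        v(2) \<phi>(3) by simp
    have 2: "u \<cdot> (s i \<cdot> d i) = (u \<cdot> s i) \<cdot> d i"
      using comp_assoc[OF m s(1) u(1)] by simp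
    have 3: "u \<cdot> (d (Suc i) \<cdot> s (Suc i)) = \<one>\<^bsub>?H\<^esub>"
      using comp_assoc[OF s(1) m u(1)] u(2) comp_zero_left[OF s(1) M] by simp
    have us: "u \<cdot> s i \<in> Mor X (P i) M" "v \<cdot> \<phi> i \<in> Mor X (P i) M"
      using comp_closed[OF s(1) u(1)] comp_closed[OF \<phi>(2) v(1)] by blast+
    have "u = u \<cdot> Id X (P (Suc i))" using Id_right[OF u(1)] by simp
    also have "\<dots> = (u \<cdot> (\<psi> (Suc i) \<cdot> \<phi> (Suc i))) \<otimes>\<^bsub>?H\<^esub>
        ((u \<cdot> (s i \<cdot> d i)) \<otimes>\<^bsub>?H\<^esub> (u \<cdot> (d (Suc i) \<cdot> s (Suc i))))"
      using s(2)[of i] comp_add_right[OF \<theta> G.m_closed[OF sd ds] u(1)] comp_add_right[OF sd ds u(1)]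
      by simp
    also have "\<dots> = ((v \<cdot> \<phi> i) \<cdot> d i) \<otimes>\<^bsub>?H\<^esub> ((u \<cdot> s i) \<cdot> d i)"
      unfolding 1 2 3 using comp_closed[OF m us(1)] by simp
    also have "\<dots> = ((v \<cdot> \<phi> i) \<otimes>\<^bsub>Hom X (P i) M\<^esub> (u \<cdot> s i)) \<cdot> d i"
      using comp_add_left[OF m us(2,1)] by simp
    finally have "u = ((v \<cdot> \<phi> i) \<otimes>\<^bsub>Hom X (P i) M\<^esub> (u \<cdot> s i)) \<cdot> d i" .
    moreover have "(v \<cdot> \<phi> i) \<otimes>\<^bsub>Hom X (P i) M\<^esub> (u \<cdot> s i) \<in> Mor X (P i) M"
      using us group.is_monoid[OF Hom_group[OF o M]] by (simp add: monoid.m_closed)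
    ultimately show "\<exists>v\<in>Mor X (P i) M. u = v \<cdot> d i" by blast
  qed
qed

end


section \<open>Balance\<close>

context half_exact_class
begin

lemma GP_subset: "GP X \<xi> \<subseteq> Obj X"
  using triD(5)[OF complete_proj_resolutionD(1)] by (auto simp: GP_def)

lemma GI_subset: "GI X \<xi> \<subseteq> Obj X"
  using triD(5)[OF complete_inj_coresolutionD(1)] by (auto simp: GI_def)

lemma zero_Proj:
  assumes "zero_object X Z"
  shows "Z \<in> Proj X \<xi>"
  unfolding Proj_def mem_Collect_eq
proof (intro conjI allI impI)
  show Z: "Z \<in> Obj X" using assms by (simp add: zero_object_def)
  show "cov_exact X {Z} A x B y C" if "tri_in X \<xi> A x B y C \<delta>" for A x B y C \<delta>
    using cov_exact_iff[OF that, of "{Z}"] zero_cov[OF assms that] Z by simp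
qed

lemma Id_contra_exact:
  assumes Z: "zero_object X Z" and P: "P \<in> Obj X" and \<W>: "\<W> \<subseteq> Obj X"
  shows "contra_exact X \<W> Z \<one>\<^bsub>Hom X Z P\<^esub> P (Id X P) P"
    and "contra_exact X \<W> P (Id X P) P \<one>\<^bsub>Hom X P Z\<^esub> Z"
proof -
  have ZO: "Z \<in> Obj X" using Z by (simp add: zero_object_def)
  obtain \<delta> \<epsilon> where T: "tri_in X \<xi> Z \<one>\<^bsub>Hom X Z P\<^esub> P (Id X P) P \<delta>"
      "tri_in X \<xi> P (Id X P) P \<one>\<^bsub>Hom X P Z\<^esub> Z \<epsilon>"
    using tri_zero_left[OF Z P] tri_zero_right[OF Z P] by blast
  have "contra_inj X W (Id X P) P" "contra_surj X W P (Id X P) P" "contra_inj X W \<one>\<^bsub>Hom X P Z\<^esub> Z"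
    for W
    unfolding contra_inj_def contra_surj_def using Id_right Mor_zero_left[OF Z] by metis+
  moreover have "contra_surj X W Z \<one>\<^bsub>Hom X Z P\<^esub> P" if W: "W \<in> Obj X" for W
    unfolding contra_surj_def
  proof
    fix u assume "u \<in> Mor X Z W"
    then have "\<one>\<^bsub>Hom X P W\<^esub> \<cdot> \<one>\<^bsub>Hom X Z P\<^esub> = u"
      using Mor_zero_left[OF Z] comp_zero_right[OF ZO zero_closed[OF P W]] by simp
    then show "\<exists>v\<in>Mor X P W. v \<cdot> \<one>\<^bsub>Hom X Z P\<^esub> = u" using zero_closed[OF P W] by blast
  qed
  ultimately show "contra_exact X \<W> Z \<one>\<^bsub>Hom X Z P\<^esub> P (Id X P) P"
    "contra_exact X \<W> P (Id X P) P \<one>\<^bsub>Hom X P Z\<^esub> Z"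
    using contra_exact_iff[OF T(1) \<W>] contra_exact_iff[OF T(2) \<W>] \<W> by auto
qed

lemma Proj_subset_GP: "Proj X \<xi> \<subseteq> GP X \<xi>"
proof
  fix P assume P: "P \<in> Proj X \<xi>"
  obtain Z where Z: "zero_object X Z" using ex_zero_object by blast
  have PO: "P \<in> Obj X" and ZO: "Z \<in> Obj X"
    using P Proj_subset Z by (auto simp: zero_object_def)
  \<comment> \<open>The complete resolution is P = P in degrees 0 and -1 with zero objects
    elsewhere; \<open>P\<close> occurs as the syzygy \<open>K 0\<close>.\<close>
  define V K where "V = (\<lambda>n::int. if n = 0 \<or> n = -1 then P else Z)"
    and "K = (\<lambda>n::int. if n = 0 then P else Z)"
  have "\<exists>g f \<delta>. tri_in X \<xi> (K (n + 1)) g (V n) f (K n) \<delta> \<and>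
      contra_exact X (Proj X \<xi>) (K (n + 1)) g (V n) f (K n)" for n
  proof -
    consider "n = 0" | "n = -1" | "n \<noteq> 0" "n \<noteq> -1" by blast
    then show ?thesis
    proof cases
      case 1
      then show ?thesis
        using tri_zero_left[OF Z PO] Id_contra_exact(1)[OF Z PO Proj_subset]
        by (auto simp: V_def K_def)
    next
      case 2
      then show ?thesis
        using tri_zero_right[OF Z PO] Id_contra_exact(2)[OF Z PO Proj_subset]
        by (auto simp: V_def K_def)
    next
      case 3
      then have "n + 1 \<noteq> 0" by linarith
      with 3 show ?thesis
        using tri_zero_left[OF Z ZO] Id_contra_exact(1)[OF Z ZO Proj_subset]
        by (auto simp: V_def K_def)
    qed
  qed
  then obtain g f \<delta> where T: "\<And>n. tri_in X \<xi> (K (n + 1)) (g n) (V n) (f n) (K n) (\<delta> n)"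
    "\<And>n. contra_exact X (Proj X \<xi>) (K (n + 1)) (g n) (V n) (f n) (K n)"
    by metis
  have "complete_proj_resolution X \<xi> V (\<lambda>n. g (n - 1) \<cdot> f n) K g f \<delta>"
    using T P zero_Proj[OF Z]
    by (simp add: complete_proj_resolution_def xi_exact_complex_def V_def)
  from GP_I[OF this, of 0] show "P \<in> GP X \<xi>" by (simp add: K_def)
qed

text \<open>Projective and zero objects are covered by themselves with zero kernel. Finite
  resolutions thus continue forever with zero kernels, and the unbounded iteration below never has
  to stop.\<close>

lemma pd_finite_cover:
  assumes "pd_finite X \<xi> K"
  shows "\<exists>K' x P y \<delta>. tri_in X \<xi> K' x P y K \<delta> \<and> P \<in> Proj X \<xi> \<and> pd_finite X \<xi> K'"
proof -
  have cover: ?thesis if P: "K \<in> Proj X \<xi>"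
  proof -
    obtain Z where Z: "zero_object X Z" using ex_zero_object by blast
    have "K \<in> Obj X" using P Proj_subset by blast
    with tri_zero_left[OF Z] P pd_le.zero[OF Z, of \<xi>] show ?thesis by (meson pd_finite_def)
  qed
  obtain n where "pd_le X \<xi> n K" using assms by (auto simp: pd_finite_def)
  then show ?thesis
  proof cases
    case zero
    then show ?thesis using cover zero_Proj by blast
  next
    case proj
    then show ?thesis using cover by blast
  next
    case (step K' x P y \<delta>)
    then show ?thesis by (meson pd_finite_def)
  qed
qed

section \<open>Resolutions exact under C(GP,-) and C(-,GI) simultaneously\<close>

definition bi_exact_tri :: "'o \<Rightarrow> 'm \<Rightarrow> 'o \<Rightarrow> 'm \<Rightarrow> 'o \<Rightarrow> 'e \<Rightarrow> bool" where
  "bi_exact_tri K' x G y K \<delta> \<longleftrightarrow> tri_in X \<xi> K' x G y K \<delta> \<and> G \<in> GP X \<xi> \<and>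
     cov_exact X (GP X \<xi>) K' x G y K \<and> contra_exact X (GI X \<xi>) K' x G y K"

lemma pd_finite_bi_exact_cover:
  assumes K: "pd_finite X \<xi> K"
  shows "\<exists>K' x G y \<delta>. bi_exact_tri K' x G y K \<delta> \<and> pd_finite X \<xi> K'"
proof -
  obtain K' x P y \<delta> where T: "tri_in X \<xi> K' x P y K \<delta>" and P: "P \<in> Proj X \<xi>"
    and K': "pd_finite X \<xi> K'"
    using pd_finite_cover[OF K] by blast
  have "cov_exact X (GP X \<xi>) K' x P y K"
    using cov_exact_iff[OF T GP_subset] GP_cov_pd_finite[OF T K'] by blast
  moreover have "contra_exact X (GI X \<xi>) K' x P y K"
    using contra_exact_iff[OF T GI_subset] GI_contra_pd_finite[OF T K'] K by blast
  ultimately show ?thesis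
    using T P K' Proj_subset_GP unfolding bi_exact_tri_def by blast
qed

text \<open>\<open>A\<close> may have infinite dimension, so injectivity under C(-,M) is taken from
  the successor itself; surjectivity follows from finite dimension of the kernel.\<close>

lemma GP_star_bi_exact_cover:
  assumes A: "A \<in> GP_star X \<xi>"
  shows "\<exists>K' x G y \<delta>. bi_exact_tri K' x G y A \<delta> \<and> pd_finite X \<xi> K'"
proof -
  obtain K x G y \<delta> where S: "is_successor X \<xi> K x G y A \<delta>"
    using A by (auto simp: GP_star_def)
  then have T: "tri_in X \<xi> K x G y A \<delta>" and K: "pd_finite X \<xi> K" by (auto simp: is_successor_def)
  have "contra_inj X M y A" if "M \<in> GI X \<xi>" for M
    using S that by (auto simp: is_successor_def mon_def inj_on_def contra_inj_def)
  then have "contra_exact X (GI X \<xi>) K x G y A"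
    using contra_exact_iff[OF T GI_subset] GI_contra_pd_finite(1)[OF T K] by blast
  with S show ?thesis unfolding is_successor_def bi_exact_tri_def by blast
qed

lemma GP_star_bi_exact_resolution:
  assumes A: "A \<in> GP_star X \<xi>"
  shows "\<exists>K g G f \<delta>. K 0 = A \<and> (\<forall>i. bi_exact_tri (K (Suc i)) (g i) (G i) (f i) (K i) (\<delta> i))"
proof -
  let ?S = "\<lambda>K K'. \<exists>x G y \<delta>. bi_exact_tri K' x G y K \<delta>"
  \<comment> \<open>Finite dimension is available only from the first kernel on, so the invariant at
    index 0 just fixes the object \<open>A\<close>.\<close>
  have "\<exists>K. \<forall>n. (if n = 0 then K n = A else pd_finite X \<xi> (K n)) \<and> ?S (K n) (K (Suc n))"
  proof (rule dependent_nat_choice)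
    fix K and n :: nat assume "if n = 0 then K = A else pd_finite X \<xi> K"
    then have "\<exists>K' x G y \<delta>. bi_exact_tri K' x G y K \<delta> \<and> pd_finite X \<xi> K'"
      using GP_star_bi_exact_cover[OF A] pd_finite_bi_exact_cover by (cases "n = 0") simp_all
    then show "\<exists>K'. (if Suc n = 0 then K' = A else pd_finite X \<xi> K') \<and> ?S K K'"
      by simp blast
  qed simp
  then obtain K where K: "\<forall>n. (if n = 0 then K n = A else pd_finite X \<xi> (K n)) \<and> ?S (K n) (K (Suc n))"
    by blast
  then have "K 0 = A" by (auto dest: spec[of _ 0])
  moreover have "\<forall>n. ?S (K n) (K (Suc n))" using K by blast
  ultimately show ?thesis by metis
qed

lemma relative_resolution_of_triangles:
  assumes T: "\<And>i. tri_in X \<xi> (K (Suc i)) (g i) (G i) (f i) (K i) (\<delta> i)"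
    and G: "\<And>i. G i \<in> \<W>" and \<W>: "\<W> \<subseteq> Obj X"
    and ex: "\<And>i. cov_exact X \<W> (K (Suc i)) (g i) (G i) (f i) (K i)"
    and d0: "d 0 = f 0" and dS: "\<And>i. d (Suc i) = g i \<cdot> f (Suc i)"
  shows "relative_resolution X \<W> (case_nat (K 0) G) d"
    and "\<lbrakk>M \<in> Obj X; \<And>i. contra_exact X {M} (K (Suc i)) (g i) (G i) (f i) (K i)\<rbrakk>
      \<Longrightarrow> contra_acyclic X (case_nat (K 0) G) d M"
proof -
  \<comment> \<open>Reading the augmentation as the identity after \<open>f 0\<close> makes
    \<open>d i = ?h i \<cdot> f i\<close> valid in every degree, so degree 0 mostly needs no
    separate argument.\<close>
  let ?P = "case_nat (K 0) G" and ?h = "case_nat (Id X (K 0)) g"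
  note D = triD[OF T]
  have inj: "cov_inj X W (K (Suc i)) (g i)" and surj: "cov_surj X W (G i) (f i) (K i)"
    if "W \<in> \<W>" for W i
    using ex that cov_exact_iff[OF T \<W>] by blast+
  have h: "?h i \<in> Mor X (K i) (?P i)" for i
    using D(1) Id_closed[OF D(5)] by (simp split: nat.split)
  have d: "d i = ?h i \<cdot> f i" for i
    using Id_left[OF D(2)] d0 dS by (simp split: nat.split)
  have hinj: "cov_inj X W (K i) (?h i)" if "W \<in> \<W>" for W i
  proof (cases i)
    case 0
    then show ?thesis using Id_left by (simp add: cov_inj_def)
  qed (use inj[OF that] in simp)
  have d_mor: "d i \<in> Mor X (G i) (?P i)" for i
    unfolding d using comp_closed[OF D(2) h] .
  have dd: "d i \<cdot> d (Suc i) = \<one>\<^bsub>Hom X (G (Suc i)) (?P i)\<^esub>" for i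
  proof -
    have "d i \<cdot> d (Suc i) = ?h i \<cdot> (f i \<cdot> (g i \<cdot> f (Suc i)))"
      using comp_assoc[OF comp_closed[OF D(2) D(1)] D(2) h] dS d by simp
    also have "\<dots> = ?h i \<cdot> ((f i \<cdot> g i) \<cdot> f (Suc i))"
      using comp_assoc[OF D(2) D(1) D(2)] by simp
    also have "\<dots> = \<one>\<^bsub>Hom X (G (Suc i)) (?P i)\<^esub>"
      using tri_comp_zero[OF T] comp_zero_left[OF D(2) D(5)] comp_zero_right[OF D(4) h] by simp
    finally show ?thesis .
  qed
  have ex0: "\<exists>v\<in>Mor X W (G 0). u = d 0 \<cdot> v" if "W \<in> \<W>" "u \<in> Mor X W (K 0)" for W u
    using cov_surjD[OF surj[OF that(1)] that(2)] d0 by metis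
  have exS: "\<exists>v\<in>Mor X W (G (Suc j)). u = d (Suc j) \<cdot> v"
    if W: "W \<in> \<W>" and u: "u \<in> Mor X W (G j)" "d j \<cdot> u = \<one>\<^bsub>Hom X W (?P j)\<^esub>" for W u j
  proof -
    have WO: "W \<in> Obj X" using W \<W> by blast
    \<comment> \<open>\<open>?h j\<close> can be cancelled on maps from test objects, so a cycle for
      \<open>d j\<close> is already killed by \<open>f j\<close>.\<close>
    have "?h j \<cdot> (f j \<cdot> u) = ?h j \<cdot> \<one>\<^bsub>Hom X W (K j)\<^esub>"
      using comp_assoc[OF u(1) D(2) h] u(2) d comp_zero_right[OF WO h] by simp
    then have "f j \<cdot> u = \<one>\<^bsub>Hom X W (K j)\<^esub>"
      using cov_injD[OF hinj[OF W]] comp_closed[OF u(1) D(2)] zero_closed[OF WO D(5)] by blast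
    then obtain w where w: "w \<in> Mor X W (K (Suc j))" "u = g j \<cdot> w"
      using weak_kernel[OF T u(1)] by blast
    obtain v where v: "v \<in> Mor X W (G (Suc j))" "f (Suc j) \<cdot> v = w"
      using cov_surjD[OF surj[OF W] w(1)] by blast
    then have "u = d (Suc j) \<cdot> v"
      using comp_assoc[OF v(1) D(2) D(1)] w(2) dS by simp
    with v show ?thesis by blast
  qed
  show "relative_resolution X \<W> ?P d"
    unfolding relative_resolution_def
  proof (intro allI conjI ballI impI)
    fix i W u
    assume "W \<in> \<W>" "u \<in> Mor X W (?P i)"
      and "case i of 0 \<Rightarrow> True | Suc j \<Rightarrow> d j \<cdot> u = \<one>\<^bsub>Hom X W (?P j)\<^esub>"
    then show "\<exists>v\<in>Mor X W (?P (Suc i)). u = d i \<cdot> v"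
      using ex0 exS by (cases i) simp_all
  qed (use G d_mor dd in simp_all)
  assume M: "M \<in> Obj X"
    and exM: "\<And>i. contra_exact X {M} (K (Suc i)) (g i) (G i) (f i) (K i)"
  have minj: "contra_inj X M (f i) (K i)" and msurj: "contra_surj X M (K (Suc i)) (g i) (G i)" for i
    using exM[of i] contra_exact_iff[OF T, of "{M}"] M by blast+
  have hsurj: "contra_surj X M (K i) (?h i) (?P i)" for i
  proof (cases i)
    case 0
    then show ?thesis using Id_right by (auto simp: contra_surj_def)
  qed (use msurj in simp)
  show "contra_acyclic X ?P d M"
    unfolding contra_acyclic_def
  proof (intro conjI allI ballI impI)
    fix u assume u: "u \<in> Mor X (?P 0) M" "u \<cdot> d 0 = \<one>\<^bsub>Hom X (?P (Suc 0)) M\<^esub>"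
    then have "u \<cdot> f 0 = \<one>\<^bsub>Hom X (K 0) M\<^esub> \<cdot> f 0"
      using comp_zero_left[OF D(2) M] d0 by simp
    then show "u = \<one>\<^bsub>Hom X (?P 0) M\<^esub>"
      using contra_injD[OF minj] u(1) zero_closed[OF D(5) M] by simp
  next
    fix i u assume "u \<in> Mor X (?P (Suc i)) M" "u \<cdot> d (Suc i) = \<one>\<^bsub>Hom X (?P (Suc (Suc i))) M\<^esub>"
    then have u: "u \<in> Mor X (G i) M" "u \<cdot> d (Suc i) = \<one>\<^bsub>Hom X (G (Suc i)) M\<^esub>" by simp_all
    have "(u \<cdot> g i) \<cdot> f (Suc i) = \<one>\<^bsub>Hom X (K (Suc i)) M\<^esub> \<cdot> f (Suc i)"
      using comp_assoc[OF D(2) D(1) u(1)] u(2) dS comp_zero_left[OF D(2) M] by simp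
    then have "u \<cdot> g i = \<one>\<^bsub>Hom X (K (Suc i)) M\<^esub>"
      using contra_injD[OF minj] comp_closed[OF D(1) u(1)] zero_closed[OF D(3) M] by blast
    then obtain w where w: "w \<in> Mor X (K i) M" "u = w \<cdot> f i"
      using weak_cokernel[OF T u(1)] by blast
    obtain v where v: "v \<in> Mor X (?P i) M" "v \<cdot> ?h i = w"
      using contra_surjD[OF hsurj w(1)] by blast
    then have "u = v \<cdot> d i"
      using comp_assoc[OF D(2) h v(1)] w(2) d by simp
    with v show "\<exists>v\<in>Mor X (?P i) M. u = v \<cdot> d i" by blast
  qed
qed

lemma proper_GP_resolution_relative:
  assumes "proper_GP_resolution X \<xi> A G d"
  shows "relative_resolution X (GP X \<xi>) (case_nat A G) d"
proof -
  obtain K g f \<delta> where K0: "K 0 = A"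
    and T: "\<And>i. tri_in X \<xi> (K (Suc i)) (g i) (G i) (f i) (K i) (\<delta> i)"
    and ex: "\<And>i. cov_exact X (GP X \<xi>) (K (Suc i)) (g i) (G i) (f i) (K i)"
    and d: "d 0 = f 0" "\<And>i. d (Suc i) = g i \<cdot> f (Suc i)"
    and G: "\<And>i. G i \<in> GP X \<xi>"
    using assms unfolding proper_GP_resolution_def by blast
  from relative_resolution_of_triangles(1)[OF T G GP_subset ex d] K0 show ?thesis by simp
qed

lemma GP_star_proper_resolution:
  assumes A: "A \<in> GP_star X \<xi>"
  shows "\<exists>G d. proper_GP_resolution X \<xi> A G d \<and> (\<forall>M\<in>GI X \<xi>. contra_acyclic X (case_nat A G) d M)"
proof -
  obtain K g G f \<delta> where K0: "K 0 = A"
    and B: "\<And>i. bi_exact_tri (K (Suc i)) (g i) (G i) (f i) (K i) (\<delta> i)"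
    using GP_star_bi_exact_resolution[OF A] by blast
  then have T: "\<And>i. tri_in X \<xi> (K (Suc i)) (g i) (G i) (f i) (K i) (\<delta> i)"
    and G: "\<And>i. G i \<in> GP X \<xi>"
    and ex: "\<And>i. cov_exact X (GP X \<xi>) (K (Suc i)) (g i) (G i) (f i) (K i)"
    and exM: "\<And>i M. M \<in> GI X \<xi> \<Longrightarrow> contra_exact X {M} (K (Suc i)) (g i) (G i) (f i) (K i)"
    by (auto simp: bi_exact_tri_def contra_exact_def)
  define d where "d = case_nat (f 0) (\<lambda>i. g i \<cdot> f (Suc i))"
  have d: "d 0 = f 0" "\<And>i. d (Suc i) = g i \<cdot> f (Suc i)" by (simp_all add: d_def)
  have "proper_GP_resolution X \<xi> A G d"
    unfolding proper_GP_resolution_def using K0 T G ex d by blast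
  moreover have "contra_acyclic X (case_nat A G) d M" if "M \<in> GI X \<xi>" for M
    using relative_resolution_of_triangles(2)[OF T G GP_subset ex d, of M] exM that GI_subset K0
    by blast
  ultimately show ?thesis by blast
qed

text \<open>Relative cohomology is computed from an arbitrarily chosen resolution, so acyclicity has
  to be carried over from the one built by hand.\<close>

lemma proper_GP_resolution_acyclic:
  assumes A: "A \<in> GP_star X \<xi>" and R: "proper_GP_resolution X \<xi> A G d" and M: "M \<in> GI X \<xi>"
  shows "contra_acyclic X (case_nat A G) d M"
proof -
  obtain G' d' where R': "proper_GP_resolution X \<xi> A G' d'"
    and ac: "contra_acyclic X (case_nat A G') d' M"
    using GP_star_proper_resolution[OF A] M by blast
  show ?thesis
    using contra_acyclic_transfer[OF proper_GP_resolution_relative[OF R]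
        proper_GP_resolution_relative[OF R'] _ ac] M GI_subset by auto
qed

lemma the_GP_resolution_proper:
  assumes "A \<in> GP_star X \<xi>"
  shows "case the_GP_resolution X \<xi> A of (G, d) \<Rightarrow> proper_GP_resolution X \<xi> A G d"
  unfolding the_GP_resolution_def
  by (rule someI_ex) (use GP_star_proper_resolution[OF assms] in auto)

end

lemma the_GI_coresolution_op_cat:
  "the_GI_coresolution X \<xi> B = the_GP_resolution (op_cat X) (op_class \<xi>) B"
  by (simp add: the_GI_coresolution_def the_GP_resolution_def proper_GP_resolution_op_cat)

theorem (in half_exact_class) xt_GP_iso_xt_GI:
  assumes A: "A \<in> GP_star X \<xi>" and B: "B \<in> GI_star X \<xi>"
  shows "xt_GP X \<xi> n A B \<cong> xt_GI X \<xi> n A B"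
proof -
  interpret op: half_exact_class "op_cat X" "op_class \<xi>" by (rule dual)
  have B': "B \<in> GP_star (op_cat X) (op_class \<xi>)" using B by (rule GI_star_op_cat)
  obtain G d where Gd: "the_GP_resolution X \<xi> A = (G, d)" by fastforce
  obtain H e where He: "the_GI_coresolution X \<xi> B = (H, e)" by fastforce
  have R: "proper_GP_resolution X \<xi> A G d"
    using the_GP_resolution_proper[OF A] Gd by simp
  have S: "proper_GP_resolution (op_cat X) (op_class \<xi>) B H e"
    using op.the_GP_resolution_proper[OF B'] He by (simp add: the_GI_coresolution_op_cat)
  let ?P = "case_nat A G" and ?J = "case_nat B H"
  note P = proper_GP_resolution_relative[OF R]
  \<comment> \<open>The coresolution of \<open>B\<close> is a resolution in the opposite category;
    read in \<open>X\<close>, \<open>e b\<close> goes from \<open>?J b\<close> to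
    \<open>?J (Suc b)\<close>.\<close>
  note J = op.proper_GP_resolution_relative[OF S]
  note Pm = relative_resolutionD(2)[OF P] and Jm = relative_resolutionD(2)[OF J, unfolded op_cat_simps]
  note PO = res_obj[OF P] and JO = op.res_obj[OF J, unfolded op_cat_simps]
  \<comment> \<open>Only positive indices qualify: \<open>?J (Suc b)\<close> is Gorenstein
    injective, whereas \<open>?J 0\<close> is \<open>B\<close>. The same holds for \<open>?P\<close>
    and \<open>A\<close> in the dual statement.\<close>
  have Pac: "contra_acyclic X ?P d (?J (Suc b))" for b
    using proper_GP_resolution_acyclic[OF A R] relative_resolutionD(1)[OF J, of b] by simp
  have Jac: "contra_acyclic (op_cat X) ?J e (?P (Suc a))" for a
    using op.proper_GP_resolution_acyclic[OF B' S] relative_resolutionD(1)[OF P, of a] by simp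
  \<comment> \<open>The corner is C(A,B), row 0 carries the groups C(G_i,B), and column 0 the groups
    C(A,H_j).\<close>
  have "double_complex (\<lambda>a b. Hom X (?P a) (?J b)) (\<lambda>a b u. u \<cdot> d a) (\<lambda>a b u. e b \<cdot> u)"
  proof (rule double_complex.intro)
    fix a b
    show "comm_group (Hom X (?P a) (?J b))" by (rule Hom_comm_group[OF PO JO])
    show "(\<lambda>u. u \<cdot> d a) \<in> hom (Hom X (?P a) (?J b)) (Hom X (?P (Suc a)) (?J b))"
      by (rule comp_hom_right[OF Pm JO])
    show "(\<lambda>u. e b \<cdot> u) \<in> hom (Hom X (?P a) (?J b)) (Hom X (?P a) (?J (Suc b)))"
      by (rule comp_hom_left[OF PO Jm])
  next
    fix x a b assume x: "x \<in> Mor X (?P a) (?J b)"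
    show "(x \<cdot> d a) \<cdot> d (Suc a) = \<one>\<^bsub>Hom X (?P (Suc (Suc a))) (?J b)\<^esub>"
      using comp_assoc[OF Pm Pm x] relative_resolutionD(3)[OF P, of a] comp_zero_right[OF PO x] by metis
    show "e (Suc b) \<cdot> (e b \<cdot> x) = \<one>\<^bsub>Hom X (?P a) (?J (Suc (Suc b)))\<^esub>"
      using comp_assoc[OF x Jm Jm] relative_resolutionD(3)[OF J, of b, unfolded op_cat_simps]
        comp_zero_left[OF x JO] by metis
    show "(e b \<cdot> x) \<cdot> d a = e b \<cdot> (x \<cdot> d a)"
      by (rule comp_assoc[OF Pm x Jm])
  next
    fix x b assume "x \<in> Mor X (?P 0) (?J (Suc b))"
      and "x \<cdot> d 0 = \<one>\<^bsub>Hom X (?P (Suc 0)) (?J (Suc b))\<^esub>"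
    then show "x = \<one>\<^bsub>Hom X (?P 0) (?J (Suc b))\<^esub>"
      using Pac[of b] unfolding contra_acyclic_def by blast
  next
    fix x a b assume "x \<in> Mor X (?P (Suc a)) (?J (Suc b))"
      and "x \<cdot> d (Suc a) = \<one>\<^bsub>Hom X (?P (Suc (Suc a))) (?J (Suc b))\<^esub>"
    then show "\<exists>y\<in>Mor X (?P a) (?J (Suc b)). x = y \<cdot> d a"
      using Pac[of b] unfolding contra_acyclic_def by blast
  next
    fix x a assume "x \<in> Mor X (?P (Suc a)) (?J 0)"
      and "e 0 \<cdot> x = \<one>\<^bsub>Hom X (?P (Suc a)) (?J (Suc 0))\<^esub>"
    then show "x = \<one>\<^bsub>Hom X (?P (Suc a)) (?J 0)\<^esub>"
      using Jac[of a] unfolding contra_acyclic_def op_cat_simps by blast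
  next
    fix x a b assume "x \<in> Mor X (?P (Suc a)) (?J (Suc b))"
      and "e (Suc b) \<cdot> x = \<one>\<^bsub>Hom X (?P (Suc a)) (?J (Suc (Suc b)))\<^esub>"
    then show "\<exists>y\<in>Mor X (?P (Suc a)) (?J b). x = e b \<cdot> y"
      using Jac[of a] unfolding contra_acyclic_def op_cat_simps by blast
  qed
  \<comment> \<open>The shift by \<open>Suc\<close> in the edge complexes drops the augmentations
    \<open>d 0\<close> and \<open>e 0\<close>, leaving the deleted complexes.\<close>
  from double_complex.balance[OF this, of n] show ?thesis
    by (simp add: xt_GP_def xt_GI_def Gd He)
qed

theorem theorem3p19:
  fixes X :: "('o, 'm, 'e) extri" and \<xi> :: "('m \<times> 'm \<times> 'e) set"
    and A B :: 'o and n :: nat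
  assumes "extriangulated_category X"
    and "WIC X"
    and "proper_class X \<xi>"
    and "enough_projectives X \<xi>"
    and "enough_injectives X \<xi>"
    and "A \<in> GP_star X \<xi>"
    and "B \<in> GI_star X \<xi>"
  shows "xt_GP X \<xi> n A B \<cong> xt_GI X \<xi> n A B"
proof -
  interpret proper_class X \<xi> by (rule assms(3))
  show ?thesis by (rule xt_GP_iso_xt_GI[OF assms(6,7)])
qed

end
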